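(* Let $\mathcal{E}$ be a locally Cartesian closed category, $T:\mathcal{E}\to\mathcal{E}$ a monad and $(\mathbb{T},+,0)$ a monoid in $\mathcal{E}$. The assignment $p\mapsto pT\text{-}\mathbf{Coalg}^{\mathbb{T}}$, sending a polynomial $p$ to the category of $pT$-coalgebras with time $\mathbb{T}$, extends to a polynomially-indexed category $(-)T\text{-}\mathbf{Coalg}^{\mathbb{T}}:\mathbf{Poly}_{\mathcal{E}}\to\mathbf{Cat}$. For a morphism of polynomials $\varphi:p\to q$, the functor $\varphi T\text{-}\mathbf{Coalg}^{\mathbb{T}}:pT\text{-}\mathbf{Coalg}^{\mathbb{T}}\to qT\text{-}\mathbf{Coalg}^{\mathbb{T}}$ sends an object $(X,\vartheta^o,\vartheta^u)$ to $(X,\ \varphi_1\circ\vartheta^o,\ \vartheta^u\circ{\vartheta^o}^{*}\varphi^{\#})$, where the two maps are explicitly $$\mathbb{T}\times X\xrightarrow{\vartheta^o}p(1)\xrightarrow{\varphi_1}q(1),\qquad \sum_{t:\mathbb{T}}\sum_{x:X}q[\varphi_1\circ\vartheta^o(t,x)]\xrightarrow{{\vartheta^o}^{*}\varphi^{\#}}\sum_{t:\mathbb{T}}\sum_{x:X}p[\vartheta^o(t,x)]\xrightarrow{\vartheta^u}TX,$$ and sends a morphism $f:(X,\vartheta^o,\vartheta^u)\to(Y,\psi^o,\psi^u)$ to the same underlying map $f:X\to Y$ of state spaces.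
   Context: Polynomials. A polynomial functor on $\mathcal{E}$ is a coproduct of representables $p=\sum_{i:p(1)}y^{p[i]}$, $y^A=\mathcal{E}(A,-)$; equivalently a bundle $p:\sum_{i:p(1)}p[i]\to p(1)$ in $\mathcal{E}$ with fibres $p[i]$. $\mathbf{Poly}_{\mathcal{E}}$ is the full subcategory of $[\mathcal{E},\mathcal{E}]$ on these. A morphism $\varphi:p\to q$ is equivalently a pair of a map $\varphi_1:p(1)\to q(1)$ and a map $\varphi^{\#}:\sum_{i:p(1)}q[\varphi_1(i)]\to\sum_{i:p(1)}p[i]$ over $p(1)$; composites are given by composing forward maps and by $(\chi\varphi)^{\#}=\varphi^{\#}\circ\varphi_1^{*}\chi^{\#}$. A section of $p$ is $\sigma:p(1)\to\sum_ip[i]$ with $p\circ\sigma=\mathrm{id}$. $pT$-coalgebras. A $pT$-coalgebra with time $\mathbb{T}$ is a triple $\vartheta=(S,\vartheta^o,\vartheta^u)$ of an object $S:\mathcal{E}$ (state space) and maps $\vartheta^o:\mathbb{T}\times S\to p(1)$, $\vartheta^u:\sum_{t:\mathbb{T}}\sum_{s:S}p[\vartheta^o(t,s)]\to TS$ such that for every section $\sigma$ of $p$ the closure $\vartheta^\sigma:\mathbb{T}\times S\to TS$, $\vartheta^\sigma(t)=\vartheta^u(t)\circ\vartheta^o(t)^{*}\sigma$ (with $\vartheta^o(t)^{*}\sigma:S\to\sum_{s:S}p[\vartheta^o(t,s)]$ the pulled-back section), is an object of $\mathbf{Cat}(\mathbf{B}\mathbb{T},\mathcal{K}\ell(T))$,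 where $\mathbf{B}\mathbb{T}$ is the one-object delooping of $\mathbb{T}$ and $\mathcal{K}\ell(T)$ the Kleisli category; i.e. $\vartheta^\sigma(0)$ is the Kleisli identity on $S$ and $\vartheta^\sigma(s+t)$ is the Kleisli composite of $\vartheta^\sigma(t)$ followed by $\vartheta^\sigma(s)$. The category $pT\text{-}\mathbf{Coalg}^{\mathbb{T}}$ has these as objects; a morphism $(X,\vartheta^o,\vartheta^u)\to(Y,\psi^o,\psi^u)$ is a map $f:X\to Y$ in $\mathcal{E}$ such that $Tf\circ\vartheta^u(t)\circ\vartheta^o(t)^{*}\sigma=\psi^u(t)\circ\psi^o(t)^{*}\sigma\circ f$ for all $t:\mathbb{T}$ and sections $\sigma$ of $p$. Identities and composition are those of maps of state spaces. An "indexed category" here is a (pseudo)functor into $\mathbf{Cat}$. *)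

theory Defs
  imports Main "HOL-Library.FuncSet"
begin

section \<open>Categories and functors\<close>

record ('o, 'a) cat =
  Obj :: "'o set"
  Arr :: "'a set"
  Dom :: "'a \<Rightarrow> 'o"
  Cod :: "'a \<Rightarrow> 'o"
  Ident :: "'o \<Rightarrow> 'a"
  Comp :: "'a \<Rightarrow> 'a \<Rightarrow> 'a"  (infixl \<open>\<cdot>\<index>\<close> 70)

definition Hom :: "('o, 'a) cat \<Rightarrow> 'o \<Rightarrow> 'o \<Rightarrow> 'a set" where
  "Hom C x y = {f \<in> Arr C. Dom C f = x \<and> Cod C f = y}"

locale category =
  fixes C :: "('o, 'a) cat" (structure)
  assumes dom_obj: "f \<in> Arr C \<Longrightarrow> Dom C f \<in> Obj C"
    and cod_obj: "f \<in> Arr C \<Longrightarrow> Cod C f \<in> Obj C"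
    and ident_hom: "x \<in> Obj C \<Longrightarrow> Ident C x \<in> Hom C x x"
    and comp_hom: "f \<in> Hom C x y \<Longrightarrow> g \<in> Hom C y z \<Longrightarrow> g \<cdot> f \<in> Hom C x z"
    and comp_ident: "f \<in> Hom C x y \<Longrightarrow> f \<cdot> Ident C x = f"
    and ident_comp: "f \<in> Hom C x y \<Longrightarrow> Ident C y \<cdot> f = f"
    and comp_assoc: "f \<in> Hom C w x \<Longrightarrow> g \<in> Hom C x y \<Longrightarrow> h \<in> Hom C y z \<Longrightarrow>
      h \<cdot> (g \<cdot> f) = (h \<cdot> g) \<cdot> f"

record ('o, 'a, 'p, 'b) cfun =
  src :: "('o, 'a) cat"
  tgt :: "('p, 'b) cat"
  omap :: "'o \<Rightarrow> 'p"
  amap :: "'a \<Rightarrow> 'b"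

text \<open>
  The maps of a functor are extensional, i.e. \<open>undefined\<close> outside the objects and
  arrows of the source, so that equality of functors is equality of records.
\<close>

definition is_functor ::
    "('o, 'a) cat \<Rightarrow> ('p, 'b) cat \<Rightarrow> ('o, 'a, 'p, 'b) cfun \<Rightarrow> bool" where
  "is_functor C D F \<longleftrightarrow>
     category C \<and> category D \<and> src F = C \<and> tgt F = D \<and>
     omap F \<in> Obj C \<rightarrow>\<^sub>E Obj D \<and> amap F \<in> Arr C \<rightarrow>\<^sub>E Arr D \<and>
     (\<forall>f \<in> Arr C. Dom D (amap F f) = omap F (Dom C f) \<and> Cod D (amap F f) = omap F (Cod C f)) \<and>
     (\<forall>x \<in> Obj C. amap F (Ident C x) = Ident D (omap F x)) \<and>
     (\<forall>x y z. \<forall>f \<in> Hom C x y. \<forall>g \<in> Hom C y z.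
        amap F (g \<cdot>\<^bsub>C\<^esub> f) = amap F g \<cdot>\<^bsub>D\<^esub> amap F f)"

definition id_functor :: "('o, 'a) cat \<Rightarrow> ('o, 'a, 'o, 'a) cfun" where
  "id_functor C = \<lparr>src = C, tgt = C, omap = (\<lambda>x \<in> Obj C. x), amap = (\<lambda>f \<in> Arr C. f)\<rparr>"

definition comp_functor ::
    "('p, 'b, 'q, 'c) cfun \<Rightarrow> ('o, 'a, 'p, 'b) cfun \<Rightarrow> ('o, 'a, 'q, 'c) cfun" where
  "comp_functor G F =
     \<lparr>src = src F, tgt = tgt G,
      omap = (\<lambda>x \<in> Obj (src F). omap G (omap F x)),
      amap = (\<lambda>f \<in> Arr (src F). amap G (amap F f))\<rparr>"

text \<open>The category of all categories whose objects and arrows have the given HOL types.\<close>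

definition Cat :: "(('o, 'a) cat, ('o, 'a, 'o, 'a) cfun) cat" where
  "Cat = \<lparr>Obj = {C. category C}, Arr = {F. is_functor (src F) (tgt F) F},
     Dom = src, Cod = tgt, Ident = id_functor, Comp = comp_functor\<rparr>"

definition is_nat_trans ::
    "('o, 'a, 'p, 'b) cfun \<Rightarrow> ('o, 'a, 'p, 'b) cfun \<Rightarrow> ('o \<Rightarrow> 'b) \<Rightarrow> bool" where
  "is_nat_trans F G \<alpha> \<longleftrightarrow>
     src F = src G \<and> tgt F = tgt G \<and>
     is_functor (src F) (tgt F) F \<and> is_functor (src G) (tgt G) G \<and>
     (\<forall>x \<in> Obj (src F). \<alpha> x \<in> Hom (tgt F) (omap F x) (omap G x)) \<and>
     (\<forall>x y. \<forall>f \<in> Hom (src F) x y.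
        \<alpha> y \<cdot>\<^bsub>tgt F\<^esub> amap F f = amap G f \<cdot>\<^bsub>tgt F\<^esub> \<alpha> x)"


section \<open>Limits\<close>

definition is_terminal :: "('o, 'a) cat \<Rightarrow> 'o \<Rightarrow> bool" where
  "is_terminal C t \<longleftrightarrow> t \<in> Obj C \<and> (\<forall>x \<in> Obj C. \<exists>!f. f \<in> Hom C x t)"

definition is_product :: "('o, 'a) cat \<Rightarrow> 'o \<Rightarrow> 'o \<Rightarrow> 'a \<Rightarrow> 'a \<Rightarrow> bool" where
  "is_product C a b p q \<longleftrightarrow>
     p \<in> Hom C (Dom C p) a \<and> q \<in> Hom C (Dom C p) b \<and>
     (\<forall>x \<in> Obj C. \<forall>f \<in> Hom C x a. \<forall>g \<in> Hom C x b.
        \<exists>!h. h \<in> Hom C x (Dom C p) \<and> p \<cdot>\<^bsub>C\<^esub> h = f \<and> q \<cdot>\<^bsub>C\<^esub> h = g)"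

definition is_pullback :: "('o, 'a) cat \<Rightarrow> 'a \<Rightarrow> 'a \<Rightarrow> 'a \<Rightarrow> 'a \<Rightarrow> bool" where
  "is_pullback C f p b t \<longleftrightarrow>
     b \<in> Hom C (Dom C b) (Dom C f) \<and> t \<in> Hom C (Dom C b) (Dom C p) \<and>
     f \<cdot>\<^bsub>C\<^esub> b = p \<cdot>\<^bsub>C\<^esub> t \<and>
     (\<forall>x \<in> Obj C. \<forall>u \<in> Hom C x (Dom C f). \<forall>v \<in> Hom C x (Dom C p).
        f \<cdot>\<^bsub>C\<^esub> u = p \<cdot>\<^bsub>C\<^esub> v \<longrightarrow>
        (\<exists>!h. h \<in> Hom C x (Dom C b) \<and> b \<cdot>\<^bsub>C\<^esub> h = u \<and> t \<cdot>\<^bsub>C\<^esub> h = v))"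

text \<open>
  A terminal object, binary products and pullbacks are chosen once and for all.
  They have their universal property only in categories in which such limits exist.
\<close>

definition One :: "('o, 'a) cat \<Rightarrow> 'o" where
  "One C = (SOME t. is_terminal C t)"

definition bang :: "('o, 'a) cat \<Rightarrow> 'o \<Rightarrow> 'a" where
  "bang C x = (THE f. f \<in> Hom C x (One C))"

definition projs :: "('o, 'a) cat \<Rightarrow> 'o \<Rightarrow> 'o \<Rightarrow> 'a \<times> 'a" where
  "projs C a b = (SOME (p, q). is_product C a b p q)"

definition pr1 :: "('o, 'a) cat \<Rightarrow> 'o \<Rightarrow> 'o \<Rightarrow> 'a" where
  "pr1 C a b = fst (projs C a b)"

definition pr2 :: "('o, 'a) cat \<Rightarrow> 'o \<Rightarrow> 'o \<Rightarrow> 'a" where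
  "pr2 C a b = snd (projs C a b)"

definition Prod :: "('o, 'a) cat \<Rightarrow> 'o \<Rightarrow> 'o \<Rightarrow> 'o" where
  "Prod C a b = Dom C (pr1 C a b)"

definition pairing :: "('o, 'a) cat \<Rightarrow> 'a \<Rightarrow> 'a \<Rightarrow> 'a" where
  "pairing C f g =
     (THE h. h \<in> Hom C (Dom C f) (Prod C (Cod C f) (Cod C g)) \<and>
             pr1 C (Cod C f) (Cod C g) \<cdot>\<^bsub>C\<^esub> h = f \<and> pr2 C (Cod C f) (Cod C g) \<cdot>\<^bsub>C\<^esub> h = g)"

definition prod_map :: "('o, 'a) cat \<Rightarrow> 'a \<Rightarrow> 'a \<Rightarrow> 'a" where
  "prod_map C f g =
     pairing C (f \<cdot>\<^bsub>C\<^esub> pr1 C (Dom C f) (Dom C g)) (g \<cdot>\<^bsub>C\<^esub> pr2 C (Dom C f) (Dom C g))"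

definition associator :: "('o, 'a) cat \<Rightarrow> 'o \<Rightarrow> 'o \<Rightarrow> 'o \<Rightarrow> 'a" where
  "associator C a b c =
     pairing C (pr1 C a b \<cdot>\<^bsub>C\<^esub> pr1 C (Prod C a b) c)
       (pairing C (pr2 C a b \<cdot>\<^bsub>C\<^esub> pr1 C (Prod C a b) c) (pr2 C (Prod C a b) c))"

text \<open>
  For \<open>f : A \<rightarrow> B\<close> and a bundle \<open>p : P \<rightarrow> B\<close>, the object \<open>pb C f p\<close> is the total space
  \<open>\<Sum>a:A. p[f(a)]\<close> of \<open>f\<^sup>*p\<close>; \<open>pb_base C f p\<close> is the bundle \<open>f\<^sup>*p\<close> itself, and
  \<open>pb_top C f p\<close> is the canonical map to \<open>P\<close>.
\<close>

definition pb_projs :: "('o, 'a) cat \<Rightarrow> 'a \<Rightarrow> 'a \<Rightarrow> 'a \<times> 'a" where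
  "pb_projs C f p = (SOME (b, t). is_pullback C f p b t)"

definition pb_base :: "('o, 'a) cat \<Rightarrow> 'a \<Rightarrow> 'a \<Rightarrow> 'a" where
  "pb_base C f p = fst (pb_projs C f p)"

definition pb_top :: "('o, 'a) cat \<Rightarrow> 'a \<Rightarrow> 'a \<Rightarrow> 'a" where
  "pb_top C f p = snd (pb_projs C f p)"

definition pb :: "('o, 'a) cat \<Rightarrow> 'a \<Rightarrow> 'a \<Rightarrow> 'o" where
  "pb C f p = Dom C (pb_base C f p)"

definition pb_lift :: "('o, 'a) cat \<Rightarrow> 'a \<Rightarrow> 'a \<Rightarrow> 'a \<Rightarrow> 'a \<Rightarrow> 'a" where
  "pb_lift C f p u v =
     (THE h. h \<in> Hom C (Dom C u) (pb C f p) \<and>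
             pb_base C f p \<cdot>\<^bsub>C\<^esub> h = u \<and> pb_top C f p \<cdot>\<^bsub>C\<^esub> h = v)"

text \<open>
  \<open>pb_map C f u v h\<close> is the map \<open>f\<^sup>*h : f\<^sup>*u \<rightarrow> f\<^sup>*v\<close> induced by a map of bundles
  \<open>h : u \<rightarrow> v\<close> over the codomain of \<open>f\<close>.
\<close>

definition pb_map :: "('o, 'a) cat \<Rightarrow> 'a \<Rightarrow> 'a \<Rightarrow> 'a \<Rightarrow> 'a \<Rightarrow> 'a" where
  "pb_map C f u v h = pb_lift C f v (pb_base C f u) (h \<cdot>\<^bsub>C\<^esub> pb_top C f u)"

text \<open>The canonical isomorphism \<open>(g \<circ> f)\<^sup>*r \<cong> f\<^sup>*(g\<^sup>*r)\<close> between chosen pullbacks.\<close>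

definition pb_comp :: "('o, 'a) cat \<Rightarrow> 'a \<Rightarrow> 'a \<Rightarrow> 'a \<Rightarrow> 'a" where
  "pb_comp C g f r =
     pb_lift C f (pb_base C g r) (pb_base C (g \<cdot>\<^bsub>C\<^esub> f) r)
       (pb_lift C g r (f \<cdot>\<^bsub>C\<^esub> pb_base C (g \<cdot>\<^bsub>C\<^esub> f) r) (pb_top C (g \<cdot>\<^bsub>C\<^esub> f) r))"


section \<open>Locally Cartesian closed categories\<close>

definition is_exponential :: "('o, 'a) cat \<Rightarrow> 'o \<Rightarrow> 'o \<Rightarrow> 'o \<Rightarrow> 'a \<Rightarrow> bool" where
  "is_exponential C a b e ev \<longleftrightarrow>
     e \<in> Obj C \<and> ev \<in> Hom C (Prod C e a) b \<and>
     (\<forall>x \<in> Obj C. \<forall>f \<in> Hom C (Prod C x a) b.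
        \<exists>!h. h \<in> Hom C x e \<and> ev \<cdot>\<^bsub>C\<^esub> prod_map C h (Ident C a) = f)"

definition cartesian_closed :: "('o, 'a) cat \<Rightarrow> bool" where
  "cartesian_closed C \<longleftrightarrow>
     category C \<and> (\<exists>t. is_terminal C t) \<and>
     (\<forall>a \<in> Obj C. \<forall>b \<in> Obj C. \<exists>p q. is_product C a b p q) \<and>
     (\<forall>a \<in> Obj C. \<forall>b \<in> Obj C. \<exists>e ev. is_exponential C a b e ev)"

definition slice :: "('o, 'a) cat \<Rightarrow> 'o \<Rightarrow> ('a, 'a \<times> 'a \<times> 'a) cat" where
  "slice C x =
     \<lparr>Obj = {f \<in> Arr C. Cod C f = x},
      Arr = {(f, h, g). f \<in> Arr C \<and> Cod C f = x \<and> g \<in> Arr C \<and> Cod C g = x \<and>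
               h \<in> Hom C (Dom C f) (Dom C g) \<and> g \<cdot>\<^bsub>C\<^esub> h = f},
      Dom = (\<lambda>(f, h, g). f),
      Cod = (\<lambda>(f, h, g). g),
      Ident = (\<lambda>f. (f, Ident C (Dom C f), f)),
      Comp = (\<lambda>(_, k, l) (f, h, _). (f, k \<cdot>\<^bsub>C\<^esub> h, l))\<rparr>"

text \<open>
  The terminal object is part of the notion, so that all finite limits exist: binary
  products in \<open>C/1\<close> are products in \<open>C\<close>, and binary products in \<open>C/x\<close> are pullbacks over \<open>x\<close>.
\<close>

definition locally_cartesian_closed :: "('o, 'a) cat \<Rightarrow> bool" where
  "locally_cartesian_closed C \<longleftrightarrow>
     category C \<and> (\<exists>t. is_terminal C t) \<and> (\<forall>x \<in> Obj C. cartesian_closed (slice C x))"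


section \<open>Monads and monoids\<close>

record ('o, 'a) monad =
  endo :: "('o, 'a, 'o, 'a) cfun"
  munit :: "'o \<Rightarrow> 'a"
  mmult :: "'o \<Rightarrow> 'a"

definition is_monad :: "('o, 'a) cat \<Rightarrow> ('o, 'a) monad \<Rightarrow> bool" where
  "is_monad C T \<longleftrightarrow>
     is_functor C C (endo T) \<and>
     is_nat_trans (id_functor C) (endo T) (munit T) \<and>
     is_nat_trans (comp_functor (endo T) (endo T)) (endo T) (mmult T) \<and>
     (\<forall>x \<in> Obj C.
        mmult T x \<cdot>\<^bsub>C\<^esub> munit T (omap (endo T) x) = Ident C (omap (endo T) x) \<and>
        mmult T x \<cdot>\<^bsub>C\<^esub> amap (endo T) (munit T x) = Ident C (omap (endo T) x) \<and>
        mmult T x \<cdot>\<^bsub>C\<^esub> mmult T (omap (endo T) x) =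
          mmult T x \<cdot>\<^bsub>C\<^esub> amap (endo T) (mmult T x))"

text \<open>
  Arrows \<open>x \<rightarrow> y\<close> of the Kleisli category are arrows \<open>x \<rightarrow> T y\<close>, tagged with \<open>x\<close> and \<open>y\<close>
  because \<open>y\<close> cannot be recovered from \<open>T y\<close>.
\<close>

definition kleisli :: "('o, 'a) cat \<Rightarrow> ('o, 'a) monad \<Rightarrow> ('o, 'o \<times> 'a \<times> 'o) cat" where
  "kleisli C T =
     \<lparr>Obj = Obj C,
      Arr = {(x, f, y). x \<in> Obj C \<and> y \<in> Obj C \<and> f \<in> Hom C x (omap (endo T) y)},
      Dom = (\<lambda>(x, f, y). x),
      Cod = (\<lambda>(x, f, y). y),
      Ident = (\<lambda>x. (x, munit T x, x)),
      Comp = (\<lambda>(_, g, z) (x, f, _). (x, mmult T z \<cdot>\<^bsub>C\<^esub> amap (endo T) g \<cdot>\<^bsub>C\<^esub> f, z))\<rparr>"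

record ('o, 'a) monoid_obj =
  mcarrier :: 'o
  madd :: 'a
  mzero :: 'a

definition is_monoid_obj :: "('o, 'a) cat \<Rightarrow> ('o, 'a) monoid_obj \<Rightarrow> bool" where
  "is_monoid_obj C M \<longleftrightarrow>
     (let m = mcarrier M; i = Ident C m in
       m \<in> Obj C \<and>
       madd M \<in> Hom C (Prod C m m) m \<and>
       mzero M \<in> Hom C (One C) m \<and>
       madd M \<cdot>\<^bsub>C\<^esub> prod_map C (madd M) i =
         madd M \<cdot>\<^bsub>C\<^esub> prod_map C i (madd M) \<cdot>\<^bsub>C\<^esub> associator C m m m \<and>
       madd M \<cdot>\<^bsub>C\<^esub> prod_map C (mzero M) i = pr2 C (One C) m \<and>
       madd M \<cdot>\<^bsub>C\<^esub> prod_map C i (mzero M) = pr1 C m (One C))"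

text \<open>
  The one-object category whose arrows are the elements \<open>1 \<rightarrow> M\<close>; the composite of \<open>t\<close>
  followed by \<open>s\<close> is \<open>s + t\<close>. Elements are global because the monad \<open>T\<close> need not be
  strong, so that composites of maps \<open>U \<times> S \<rightarrow> T S\<close> need not make sense.
\<close>

definition delooping :: "('o, 'a) cat \<Rightarrow> ('o, 'a) monoid_obj \<Rightarrow> (unit, 'a) cat" where
  "delooping C M =
     \<lparr>Obj = {()},
      Arr = Hom C (One C) (mcarrier M),
      Dom = (\<lambda>t. ()),
      Cod = (\<lambda>t. ()),
      Ident = (\<lambda>x. mzero M),
      Comp = (\<lambda>s t. madd M \<cdot>\<^bsub>C\<^esub> pairing C s t)\<rparr>"


section \<open>Polynomials\<close>

text \<open>
  A polynomial is a bundle, that is an arrow \<open>p : (\<Sum>i. p[i]) \<rightarrow> p(1)\<close>. An arrow from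
  \<open>p\<close> to \<open>q\<close> is a quadruple \<open>(p, \<phi>\<^sub>1, \<phi>\<^sup>#, q)\<close>, where \<open>\<phi>\<^sup>#\<close> is a map from the bundle
  \<open>\<phi>\<^sub>1\<^sup>*q\<close> to the bundle \<open>p\<close> over \<open>p(1)\<close>. As pullbacks are chosen, \<open>\<phi>\<^sub>1\<^sup>*\<chi>\<^sup>#\<close> has to be
  preceded by the comparison \<open>(\<chi>\<^sub>1 \<circ> \<phi>\<^sub>1)\<^sup>*r \<cong> \<phi>\<^sub>1\<^sup>*(\<chi>\<^sub>1\<^sup>*r)\<close> in composites, and the backward
  part of the identity on \<open>p\<close> is the canonical map from \<open>id\<^sup>*p\<close> to \<open>p\<close>.
\<close>

definition poly_comp :: "('o, 'a) cat \<Rightarrow> 'a \<times> 'a \<times> 'a \<times> 'a \<Rightarrow> 'a \<times> 'a \<times> 'a \<times> 'a \<Rightarrow>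
    'a \<times> 'a \<times> 'a \<times> 'a" where
  "poly_comp E = (\<lambda>(_, \<chi>1, \<chi>s, r) (p, \<phi>1, \<phi>s, q).
     (p, \<chi>1 \<cdot>\<^bsub>E\<^esub> \<phi>1,
      \<phi>s \<cdot>\<^bsub>E\<^esub> pb_map E \<phi>1 (pb_base E \<chi>1 r) q \<chi>s \<cdot>\<^bsub>E\<^esub> pb_comp E \<chi>1 \<phi>1 r, r))"

definition Poly :: "('o, 'a) cat \<Rightarrow> ('a, 'a \<times> 'a \<times> 'a \<times> 'a) cat" where
  "Poly E =
     \<lparr>Obj = Arr E,
      Arr = {(p, \<phi>1, \<phi>s, q). p \<in> Arr E \<and> q \<in> Arr E \<and> \<phi>1 \<in> Hom E (Cod E p) (Cod E q) \<and>
               \<phi>s \<in> Hom E (pb E \<phi>1 q) (Dom E p) \<and> p \<cdot>\<^bsub>E\<^esub> \<phi>s = pb_base E \<phi>1 q},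
      Dom = (\<lambda>(p, \<phi>1, \<phi>s, q). p),
      Cod = (\<lambda>(p, \<phi>1, \<phi>s, q). q),
      Ident = (\<lambda>p. (p, Ident E (Cod E p), pb_top E (Ident E (Cod E p)) p, p)),
      Comp = poly_comp E\<rparr>"

definition is_section :: "('o, 'a) cat \<Rightarrow> 'a \<Rightarrow> 'a \<Rightarrow> bool" where
  "is_section E p \<sigma> \<longleftrightarrow>
     \<sigma> \<in> Hom E (Cod E p) (Dom E p) \<and> p \<cdot>\<^bsub>E\<^esub> \<sigma> = Ident E (Cod E p)"

text \<open>The section \<open>f\<^sup>*\<sigma>\<close> of \<open>f\<^sup>*p\<close> induced by a section \<open>\<sigma>\<close> of \<open>p\<close>.\<close>

definition pb_section :: "('o, 'a) cat \<Rightarrow> 'a \<Rightarrow> 'a \<Rightarrow> 'a \<Rightarrow> 'a" where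
  "pb_section E f p \<sigma> = pb_lift E f p (Ident E (Dom E f)) (\<sigma> \<cdot>\<^bsub>E\<^esub> f)"


section \<open>Coalgebras with time\<close>

text \<open>
  For \<open>t : 1 \<rightarrow> M\<close>, the arrow \<open>at_time E t S\<close> is \<open>s \<mapsto> (t, s)\<close>; it is used to form
  \<open>\<theta>\<^sup>o(t)\<close> and \<open>\<theta>\<^sup>u(t)\<close>.
\<close>

definition at_time :: "('o, 'a) cat \<Rightarrow> 'a \<Rightarrow> 'o \<Rightarrow> 'a" where
  "at_time E t S = pairing E (t \<cdot>\<^bsub>E\<^esub> bang E S) (Ident E S)"

definition out_at :: "('o, 'a) cat \<Rightarrow> 'o \<times> 'a \<times> 'a \<Rightarrow> 'a \<Rightarrow> 'a" where
  "out_at E = (\<lambda>(S, \<theta>o, \<theta>u) t. \<theta>o \<cdot>\<^bsub>E\<^esub> at_time E t S)"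

definition upd_at :: "('o, 'a) cat \<Rightarrow> 'a \<Rightarrow> 'o \<times> 'a \<times> 'a \<Rightarrow> 'a \<Rightarrow> 'a" where
  "upd_at E p = (\<lambda>(S, \<theta>o, \<theta>u) t.
     \<theta>u \<cdot>\<^bsub>E\<^esub> pb_lift E \<theta>o p
       (at_time E t S \<cdot>\<^bsub>E\<^esub> pb_base E (\<theta>o \<cdot>\<^bsub>E\<^esub> at_time E t S) p)
       (pb_top E (\<theta>o \<cdot>\<^bsub>E\<^esub> at_time E t S) p))"

definition closure_at :: "('o, 'a) cat \<Rightarrow> 'a \<Rightarrow> 'o \<times> 'a \<times> 'a \<Rightarrow> 'a \<Rightarrow> 'a \<Rightarrow> 'a" where
  "closure_at E p \<theta> \<sigma> t = upd_at E p \<theta> t \<cdot>\<^bsub>E\<^esub> pb_section E (out_at E \<theta> t) p \<sigma>"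

definition closure_functor ::
    "('o, 'a) cat \<Rightarrow> ('o, 'a) monad \<Rightarrow> ('o, 'a) monoid_obj \<Rightarrow> 'a \<Rightarrow> 'o \<times> 'a \<times> 'a \<Rightarrow> 'a \<Rightarrow>
     (unit, 'a, 'o, 'o \<times> 'a \<times> 'o) cfun" where
  "closure_functor E T M p \<theta> \<sigma> =
     \<lparr>src = delooping E M, tgt = kleisli E T,
      omap = (\<lambda>x \<in> Obj (delooping E M). fst \<theta>),
      amap = (\<lambda>t \<in> Arr (delooping E M). (fst \<theta>, closure_at E p \<theta> \<sigma> t, fst \<theta>))\<rparr>"

definition is_coalgebra ::
    "('o, 'a) cat \<Rightarrow> ('o, 'a) monad \<Rightarrow> ('o, 'a) monoid_obj \<Rightarrow> 'a \<Rightarrow> 'o \<times> 'a \<times> 'a \<Rightarrow> bool" where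
  "is_coalgebra E T M p = (\<lambda>(S, \<theta>o, \<theta>u).
     S \<in> Obj E \<and>
     \<theta>o \<in> Hom E (Prod E (mcarrier M) S) (Cod E p) \<and>
     \<theta>u \<in> Hom E (pb E \<theta>o p) (omap (endo T) S) \<and>
     (\<forall>\<sigma>. is_section E p \<sigma> \<longrightarrow>
        is_functor (delooping E M) (kleisli E T) (closure_functor E T M p (S, \<theta>o, \<theta>u) \<sigma>)))"

text \<open>
  An arrow is an arrow of state spaces, tagged with its source and target coalgebra.
\<close>

definition Coalg :: "('o, 'a) cat \<Rightarrow> ('o, 'a) monad \<Rightarrow> ('o, 'a) monoid_obj \<Rightarrow> 'a \<Rightarrow>
    ('o \<times> 'a \<times> 'a, ('o \<times> 'a \<times> 'a) \<times> 'a \<times> ('o \<times> 'a \<times> 'a)) cat" where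
  "Coalg E T M p =
     \<lparr>Obj = {\<theta>. is_coalgebra E T M p \<theta>},
      Arr = {(\<theta>, f, \<psi>). is_coalgebra E T M p \<theta> \<and> is_coalgebra E T M p \<psi> \<and>
               f \<in> Hom E (fst \<theta>) (fst \<psi>) \<and>
               (\<forall>t \<in> Hom E (One E) (mcarrier M). \<forall>\<sigma>. is_section E p \<sigma> \<longrightarrow>
                  amap (endo T) f \<cdot>\<^bsub>E\<^esub> closure_at E p \<theta> \<sigma> t = closure_at E p \<psi> \<sigma> t \<cdot>\<^bsub>E\<^esub> f)},
      Dom = (\<lambda>(\<theta>, f, \<psi>). \<theta>),
      Cod = (\<lambda>(\<theta>, f, \<psi>). \<psi>),
      Ident = (\<lambda>\<theta>. (\<theta>, Ident E (fst \<theta>), \<theta>)),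
      Comp = (\<lambda>(_, g, \<chi>) (\<theta>, f, _). (\<theta>, g \<cdot>\<^bsub>E\<^esub> f, \<chi>))\<rparr>"

end

theory Submission
  imports Defs
begin

text \<open>
  In the internal language, a morphism of polynomials \<open>\<phi> : p \<rightarrow> q\<close> turns a position \<open>i\<close> of \<open>p\<close> into
  the position \<open>\<phi>\<^sub>1(i)\<close> of \<open>q\<close>, and a direction \<open>d\<close> of \<open>q\<close> at \<open>\<phi>\<^sub>1(i)\<close> back into the direction
  \<open>\<phi>\<^sup>#(i, d)\<close> of \<open>p\<close> at \<open>i\<close>. A coalgebra \<open>(X, \<theta>\<^sup>o, \<theta>\<^sup>u)\<close> for \<open>p\<close> is pushed along \<open>\<phi>\<close> by showing
  \<open>\<phi>\<^sub>1(\<theta>\<^sup>o(t, x))\<close> to the environment and translating its answer back before applying \<open>\<theta>\<^sup>u\<close>.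
  Two facts make this a functor from polynomials to categories.

  The translation of answers along \<open>f : A \<rightarrow> p(1)\<close> is the map
  \<open>\<Sum>a. q[\<phi>\<^sub>1(f(a))] \<rightarrow> \<Sum>a. p[f(a)]\<close> sending \<open>(a, d)\<close> to \<open>(a, \<phi>\<^sup>#(f(a), d))\<close>. It is
  built from chosen pullbacks and a comparison isomorphism, but its two projections do not
  mention that isomorphism (\<open>pb_backward\<close>), and projections determine maps into a pullback.
  So the translation of a composite is the composite of the translations, on the nose
  (\<open>pb_backward_comp\<close>), and the translation along an identity is an identity
  (\<open>pb_backward_ident\<close>). For \<open>f = \<phi>\<^sub>1\<close> this gives the category laws for polynomials, and for
  \<open>f = \<theta>\<^sup>o\<close> that pushing coalgebras respects identities and composition strictly.

  A section \<open>\<sigma>\<close> of \<open>q\<close> pulls back to the section \<open>i \<mapsto> \<phi>\<^sup>#(i, \<sigma>(\<phi>\<^sub>1(i)))\<close> of \<open>p\<close>, and the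
  closure of the pushed coalgebra by \<open>\<sigma>\<close> equals the closure of the original one by this
  section (\<open>closure_push_coalgebra\<close>). Hence the closures of the pushed coalgebra are among
  those of the original coalgebra, so they are functors on the delooping of time, and a map
  of state spaces that commutes with all closures before pushing still does so afterwards.
  Thus objects go to objects and morphisms to morphisms with the same underlying map.
\<close>

section \<open>Composition without named domains\<close>

context category
begin

lemma hom_iff: "f \<in> Hom C x y \<longleftrightarrow> f \<in> Arr C \<and> Dom C f = x \<and> Cod C f = y"
  by (simp add: Hom_def)

lemma comp_arr [simp]:
  assumes "f \<in> Arr C" "g \<in> Arr C" "Cod C f = Dom C g"
  shows "g \<cdot> f \<in> Arr C" "Dom C (g \<cdot> f) = Dom C f" "Cod C (g \<cdot> f) = Cod C g"
  using comp_hom[of f "Dom C f" "Cod C f" g "Cod C g"] assms by (auto simp: hom_iff)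

lemma comp_assoc_arr [simp]:
  assumes "f \<in> Arr C" "g \<in> Arr C" "h \<in> Arr C" "Cod C f = Dom C g" "Cod C g = Dom C h"
  shows "(h \<cdot> g) \<cdot> f = h \<cdot> (g \<cdot> f)"
  using comp_assoc[of f "Dom C f" "Cod C f" g "Cod C g" h "Cod C h"] assms
  by (auto simp: hom_iff)

lemma ident_arr [simp]:
  assumes "x \<in> Obj C"
  shows "Ident C x \<in> Arr C" "Dom C (Ident C x) = x" "Cod C (Ident C x) = x"
  using ident_hom[OF assms] by (auto simp: hom_iff)

lemma comp_ident_arr [simp]: "f \<in> Arr C \<Longrightarrow> Dom C f = x \<Longrightarrow> f \<cdot> Ident C x = f"
  using comp_ident[of f x "Cod C f"] by (auto simp: hom_iff)

lemma ident_comp_arr [simp]: "f \<in> Arr C \<Longrightarrow> Cod C f = x \<Longrightarrow> Ident C x \<cdot> f = f"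
  using ident_comp[of f "Dom C f" x] by (auto simp: hom_iff)

lemmas [simp] = dom_obj cod_obj

end


section \<open>Calculus of chosen pullbacks\<close>

locale pullback_category = category E for E :: "('o, 'a) cat" (structure) +
  assumes has_pullbacks:
    "f \<in> Arr E \<Longrightarrow> p \<in> Arr E \<Longrightarrow> Cod E f = Cod E p \<Longrightarrow> \<exists>b t. is_pullback E f p b t"
begin

lemma pb_is_pullback:
  assumes "f \<in> Arr E" "p \<in> Arr E" "Cod E f = Cod E p"
  shows "is_pullback E f p (pb_base E f p) (pb_top E f p)"
proof -
  have "\<exists>bt. case bt of (b, t) \<Rightarrow> is_pullback E f p b t"
    using has_pullbacks[OF assms] by auto
  from someI_ex[OF this] show ?thesis
    by (simp add: pb_base_def pb_top_def pb_projs_def case_prod_unfold)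
qed

lemma pb_projections [simp]:
  assumes "f \<in> Arr E" "p \<in> Arr E" "Cod E f = Cod E p"
  shows "pb_base E f p \<in> Arr E" "Dom E (pb_base E f p) = pb E f p"
    "Cod E (pb_base E f p) = Dom E f"
    "pb_top E f p \<in> Arr E" "Dom E (pb_top E f p) = pb E f p" "Cod E (pb_top E f p) = Dom E p"
    "f \<cdot> pb_base E f p = p \<cdot> pb_top E f p" "pb E f p \<in> Obj E"
proof -
  show 1: "pb_base E f p \<in> Arr E" "Dom E (pb_base E f p) = pb E f p"
    "Cod E (pb_base E f p) = Dom E f"
    "pb_top E f p \<in> Arr E" "Dom E (pb_top E f p) = pb E f p" "Cod E (pb_top E f p) = Dom E p"
    "f \<cdot> pb_base E f p = p \<cdot> pb_top E f p"
    using pb_is_pullback[OF assms] by (auto simp: is_pullback_def hom_iff pb_def)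
  show "pb E f p \<in> Obj E"
    using dom_obj[OF 1(1)] 1(2) by simp
qed

lemma pb_ex1_lift:
  assumes "f \<in> Arr E" "p \<in> Arr E" "Cod E f = Cod E p"
    and "u \<in> Arr E" "v \<in> Arr E" "Dom E u = Dom E v" "Cod E u = Dom E f" "Cod E v = Dom E p"
    and "f \<cdot> u = p \<cdot> v"
  shows "\<exists>!h. h \<in> Hom E (Dom E u) (pb E f p) \<and> pb_base E f p \<cdot> h = u \<and> pb_top E f p \<cdot> h = v"
  using pb_is_pullback[OF assms(1-3)] assms(4-) dom_obj[OF assms(4)]
  unfolding is_pullback_def pb_def by (auto simp: hom_iff)

lemma pb_lift [simp]:
  assumes "f \<in> Arr E" "p \<in> Arr E" "Cod E f = Cod E p"
    and "u \<in> Arr E" "v \<in> Arr E" "Dom E u = Dom E v" "Cod E u = Dom E f" "Cod E v = Dom E p"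
    and "f \<cdot> u = p \<cdot> v"
  shows "pb_lift E f p u v \<in> Arr E" "Dom E (pb_lift E f p u v) = Dom E u"
    "Cod E (pb_lift E f p u v) = pb E f p"
    "pb_base E f p \<cdot> pb_lift E f p u v = u" "pb_top E f p \<cdot> pb_lift E f p u v = v"
  using theI'[OF pb_ex1_lift[OF assms]] by (auto simp: pb_lift_def hom_iff)

lemma pb_ext:
  assumes "f \<in> Arr E" "p \<in> Arr E" "Cod E f = Cod E p"
    and "h \<in> Arr E" "k \<in> Arr E" "Dom E h = Dom E k" "Cod E h = pb E f p" "Cod E k = pb E f p"
    and "pb_base E f p \<cdot> h = pb_base E f p \<cdot> k" "pb_top E f p \<cdot> h = pb_top E f p \<cdot> k"
  shows "h = k"
proof -
  have "f \<cdot> (pb_base E f p \<cdot> h) = p \<cdot> (pb_top E f p \<cdot> h)"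
    using assms(1-8) comp_assoc_arr[of h "pb_base E f p" f] by simp
  then have "\<exists>!l. l \<in> Hom E (Dom E h) (pb E f p) \<and> pb_base E f p \<cdot> l = pb_base E f p \<cdot> h \<and>
      pb_top E f p \<cdot> l = pb_top E f p \<cdot> h"
    using pb_ex1_lift[of f p "pb_base E f p \<cdot> h" "pb_top E f p \<cdot> h"] assms by simp
  then show ?thesis
    using assms by (auto simp: hom_iff)
qed

text \<open>
  Maps into a pullback are handled as pairs \<open>(u, v)\<close>; precomposition acts componentwise.
\<close>

lemma pb_lift_comp [simp]:
  assumes "f \<in> Arr E" "p \<in> Arr E" "Cod E f = Cod E p"
    and "u \<in> Arr E" "v \<in> Arr E" "Dom E u = Dom E v" "Cod E u = Dom E f" "Cod E v = Dom E p"
    and "f \<cdot> u = p \<cdot> v" and "w \<in> Arr E" "Cod E w = Dom E v"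
  shows "pb_lift E f p u v \<cdot> w = pb_lift E f p (u \<cdot> w) (v \<cdot> w)"
proof -
  have c: "f \<cdot> (u \<cdot> w) = p \<cdot> (v \<cdot> w)"
    using assms comp_assoc_arr[of w u f] by simp
  show ?thesis
    by (rule pb_ext[of f p])
      (use assms c comp_assoc_arr[of w "pb_lift E f p u v" "pb_base E f p"]
        comp_assoc_arr[of w "pb_lift E f p u v" "pb_top E f p"] in auto)
qed

lemma pb_lift_projections [simp]:
  assumes "f \<in> Arr E" "p \<in> Arr E" "Cod E f = Cod E p"
  shows "pb_lift E f p (pb_base E f p) (pb_top E f p) = Ident E (pb E f p)"
  by (rule pb_ext[of f p]) (use assms in auto)

end


section \<open>Polynomials and reindexed backward maps\<close>

text \<open>
  The backward part of a morphism \<open>(p, \<phi>1, \<phi>s, q)\<close>, reindexed along \<open>f : A \<rightarrow> p(1)\<close>: the map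
  \<open>(a, d) \<mapsto> (a, \<phi>\<^sup>#(f(a), d))\<close> from \<open>\<Sum>a. q[\<phi>\<^sub>1(f(a))]\<close> to \<open>\<Sum>a. p[f(a)]\<close>. Composition
  of polynomials (with \<open>f = \<phi>\<^sub>1\<close>) and the action on coalgebras (with \<open>f = \<theta>\<^sup>o\<close>) are both
  instances of it.
\<close>

definition pb_backward :: "('o, 'a) cat \<Rightarrow> 'a \<Rightarrow> 'a \<Rightarrow> 'a \<Rightarrow> 'a \<Rightarrow> 'a \<Rightarrow> 'a" where
  "pb_backward E f p \<phi>1 \<phi>s q = pb_map E f (pb_base E \<phi>1 q) p \<phi>s \<cdot>\<^bsub>E\<^esub> pb_comp E \<phi>1 f q"

context pullback_category
begin

lemma poly_arr_iff:
  "(p, \<phi>1, \<phi>s, q) \<in> Arr (Poly E) \<longleftrightarrow>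
     p \<in> Arr E \<and> q \<in> Arr E \<and> \<phi>1 \<in> Arr E \<and> Dom E \<phi>1 = Cod E p \<and> Cod E \<phi>1 = Cod E q \<and>
     \<phi>s \<in> Arr E \<and> Dom E \<phi>s = pb E \<phi>1 q \<and> Cod E \<phi>s = Dom E p \<and> p \<cdot> \<phi>s = pb_base E \<phi>1 q"
  by (auto simp: Poly_def hom_iff)

lemma poly_comp_backward [simp]:
  assumes "(p, \<phi>1, \<phi>s, q) \<in> Arr (Poly E)" "w \<in> Arr E" "Cod E w = pb E \<phi>1 q"
  shows "p \<cdot> (\<phi>s \<cdot> w) = pb_base E \<phi>1 q \<cdot> w"
  using assms comp_assoc_arr[of w \<phi>s p] by (simp add: poly_arr_iff)

text \<open>
  The two factors are kept apart because composition in \<open>Poly\<close> associates them differently.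
  In the projections of the composite the comparison isomorphism has disappeared.
\<close>

lemma pb_backward_parts:
  assumes \<phi>: "(p, \<phi>1, \<phi>s, q) \<in> Arr (Poly E)" and f: "f \<in> Arr E" "Cod E f = Cod E p"
  defines "m \<equiv> pb_map E f (pb_base E \<phi>1 q) p \<phi>s" and "c \<equiv> pb_comp E \<phi>1 f q"
  shows "m \<in> Arr E" "Dom E m = pb E f (pb_base E \<phi>1 q)" "Cod E m = pb E f p"
    "c \<in> Arr E" "Dom E c = pb E (\<phi>1 \<cdot> f) q" "Cod E c = pb E f (pb_base E \<phi>1 q)"
    "pb_base E f p \<cdot> (m \<cdot> c) = pb_base E (\<phi>1 \<cdot> f) q"
    "pb_top E f p \<cdot> (m \<cdot> c) =
       \<phi>s \<cdot> pb_lift E \<phi>1 q (f \<cdot> pb_base E (\<phi>1 \<cdot> f) q) (pb_top E (\<phi>1 \<cdot> f) q)"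
proof -
  note \<phi>' = \<phi>[unfolded poly_arr_iff]
  let ?B = "pb_base E \<phi>1 q" and ?b = "pb_base E (\<phi>1 \<cdot> f) q" and ?t = "pb_top E (\<phi>1 \<cdot> f) q"
  have sq: "\<phi>1 \<cdot> (f \<cdot> ?b) = q \<cdot> ?t"
    using \<phi>' f pb_projections(7)[of "\<phi>1 \<cdot> f" q] by (simp del: pb_projections(7))
  let ?l = "pb_lift E \<phi>1 q (f \<cdot> ?b) ?t"
  have l: "?l \<in> Arr E" "Dom E ?l = pb E (\<phi>1 \<cdot> f) q" "Cod E ?l = pb E \<phi>1 q" "?B \<cdot> ?l = f \<cdot> ?b"
    using \<phi>' f sq by auto
  have c_eq: "c = pb_lift E f ?B ?b ?l"
    by (simp add: c_def pb_comp_def)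
  show c: "c \<in> Arr E" "Dom E c = pb E (\<phi>1 \<cdot> f) q" "Cod E c = pb E f ?B"
    unfolding c_eq using \<phi>' f l by auto
  have cp: "pb_base E f ?B \<cdot> c = ?b" "pb_top E f ?B \<cdot> c = ?l"
    unfolding c_eq using \<phi>' f l by auto
  have ms: "f \<cdot> pb_base E f ?B = p \<cdot> (\<phi>s \<cdot> pb_top E f ?B)"
    using \<phi> \<phi>' f by auto
  show m: "m \<in> Arr E" "Dom E m = pb E f ?B" "Cod E m = pb E f p"
    unfolding m_def pb_map_def using \<phi>' f ms by auto
  have mp: "pb_base E f p \<cdot> m = pb_base E f ?B" "pb_top E f p \<cdot> m = \<phi>s \<cdot> pb_top E f ?B"
    unfolding m_def pb_map_def using \<phi>' f ms by auto
  show "pb_base E f p \<cdot> (m \<cdot> c) = ?b"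
    using comp_assoc_arr[of c m "pb_base E f p"] m c mp cp \<phi>' f by simp
  show "pb_top E f p \<cdot> (m \<cdot> c) = \<phi>s \<cdot> ?l"
    using comp_assoc_arr[of c m "pb_top E f p"] m c mp cp \<phi>' f by simp
qed

lemma pb_backward:
  assumes "(p, \<phi>1, \<phi>s, q) \<in> Arr (Poly E)" "f \<in> Arr E" "Cod E f = Cod E p"
  shows "pb_backward E f p \<phi>1 \<phi>s q \<in> Arr E"
    "Dom E (pb_backward E f p \<phi>1 \<phi>s q) = pb E (\<phi>1 \<cdot> f) q"
    "Cod E (pb_backward E f p \<phi>1 \<phi>s q) = pb E f p"
    "pb_base E f p \<cdot> pb_backward E f p \<phi>1 \<phi>s q = pb_base E (\<phi>1 \<cdot> f) q"
    "pb_top E f p \<cdot> pb_backward E f p \<phi>1 \<phi>s q =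
       \<phi>s \<cdot> pb_lift E \<phi>1 q (f \<cdot> pb_base E (\<phi>1 \<cdot> f) q) (pb_top E (\<phi>1 \<cdot> f) q)"
  using pb_backward_parts[OF assms] by (auto simp: pb_backward_def)

text \<open>
  The formula \<open>(a, d) \<mapsto> (a, \<phi>\<^sup>#(f(a), d))\<close> for generalized elements: the arrows \<open>u\<close> and \<open>v\<close>
  are a family of such pairs.
\<close>

lemma pb_backward_lift:
  assumes \<phi>: "(p, \<phi>1, \<phi>s, q) \<in> Arr (Poly E)" and f: "f \<in> Arr E" "Cod E f = Cod E p"
    and uv: "u \<in> Arr E" "v \<in> Arr E" "Dom E u = Dom E v" "Cod E u = Dom E f" "Cod E v = Dom E q"
      "\<phi>1 \<cdot> (f \<cdot> u) = q \<cdot> v"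
  shows "pb_backward E f p \<phi>1 \<phi>s q \<cdot> pb_lift E (\<phi>1 \<cdot> f) q u v =
    pb_lift E f p u (\<phi>s \<cdot> pb_lift E \<phi>1 q (f \<cdot> u) v)"
    (is "?R \<cdot> ?w = _")
proof -
  note \<phi>' = \<phi>[unfolded poly_arr_iff] and R = pb_backward[OF \<phi> f]
  let ?b = "pb_base E (\<phi>1 \<cdot> f) q" and ?t = "pb_top E (\<phi>1 \<cdot> f) q"
  have w: "?w \<in> Arr E" "Dom E ?w = Dom E u" "Cod E ?w = pb E (\<phi>1 \<cdot> f) q" "?b \<cdot> ?w = u" "?t \<cdot> ?w = v"
    using \<phi>' f uv by auto
  have sq: "\<phi>1 \<cdot> (f \<cdot> ?b) = q \<cdot> ?t"
    using \<phi>' f pb_projections(7)[of "\<phi>1 \<cdot> f" q] by (simp del: pb_projections(7))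
  define x where "x = \<phi>s \<cdot> pb_lift E \<phi>1 q (f \<cdot> u) v"
  have x: "x \<in> Arr E" "Dom E x = Dom E u" "Cod E x = Dom E p" "f \<cdot> u = p \<cdot> x"
    using \<phi> \<phi>' f uv by (auto simp: x_def)
  have Rw: "pb_base E f p \<cdot> (?R \<cdot> ?w) = u" "pb_top E f p \<cdot> (?R \<cdot> ?w) = x"
    using comp_assoc_arr[of ?w ?R "pb_base E f p"] comp_assoc_arr[of ?w ?R "pb_top E f p"]
      R w \<phi>' f sq by (simp_all add: x_def)
  have "?R \<cdot> ?w = pb_lift E f p u x"
    by (rule pb_ext[of f p]) (use Rw R(1-3) w(1-3) x \<phi>' f uv(1-5) in auto)
  then show ?thesis by (simp only: x_def)
qed

lemma poly_comp_eq:
  assumes \<phi>: "(p, \<phi>1, \<phi>s, q) \<in> Arr (Poly E)" and \<chi>: "(q, \<chi>1, \<chi>s, r) \<in> Arr (Poly E)"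
  shows "(q, \<chi>1, \<chi>s, r) \<cdot>\<^bsub>Poly E\<^esub> (p, \<phi>1, \<phi>s, q) =
    (p, \<chi>1 \<cdot> \<phi>1, \<phi>s \<cdot> pb_backward E \<phi>1 q \<chi>1 \<chi>s r, r)"
  using pb_backward_parts[OF \<chi>, of \<phi>1] \<phi>[unfolded poly_arr_iff]
  by (simp add: Poly_def poly_comp_def pb_backward_def)

lemma poly_comp_arr:
  assumes \<phi>: "(p, \<phi>1, \<phi>s, q) \<in> Arr (Poly E)" and \<chi>: "(q, \<chi>1, \<chi>s, r) \<in> Arr (Poly E)"
  shows "(p, \<chi>1 \<cdot> \<phi>1, \<phi>s \<cdot> pb_backward E \<phi>1 q \<chi>1 \<chi>s r, r) \<in> Arr (Poly E)"
  using pb_backward[OF \<chi>, of \<phi>1] \<phi> \<phi>[unfolded poly_arr_iff] \<chi>[unfolded poly_arr_iff]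
  by (simp add: poly_arr_iff[of p "\<chi>1 \<cdot> \<phi>1"])

text \<open>
  Both sides send \<open>(a, d)\<close> to \<open>(a, \<phi>\<^sup>#(f(a), \<chi>\<^sup>#(\<phi>\<^sub>1(f(a)), d)))\<close>. Associativity in \<open>Poly\<close> and
  strict functoriality of the action on coalgebras both reduce to this equation.
\<close>

lemma pb_backward_comp:
  assumes \<phi>: "(p, \<phi>1, \<phi>s, q) \<in> Arr (Poly E)" and \<chi>: "(q, \<chi>1, \<chi>s, r) \<in> Arr (Poly E)"
    and f: "f \<in> Arr E" "Cod E f = Cod E p"
  shows "pb_backward E f p (\<chi>1 \<cdot> \<phi>1) (\<phi>s \<cdot> pb_backward E \<phi>1 q \<chi>1 \<chi>s r) r =
    pb_backward E f p \<phi>1 \<phi>s q \<cdot> pb_backward E (\<phi>1 \<cdot> f) q \<chi>1 \<chi>s r"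
    (is "?A = ?R \<cdot> ?S")
proof -
  note \<phi>' = \<phi>[unfolded poly_arr_iff] and \<chi>' = \<chi>[unfolded poly_arr_iff]
  let ?Q = "pb_backward E \<phi>1 q \<chi>1 \<chi>s r"
  let ?b = "pb_base E (\<chi>1 \<cdot> (\<phi>1 \<cdot> f)) r" and ?t = "pb_top E (\<chi>1 \<cdot> (\<phi>1 \<cdot> f)) r"
  \<comment> \<open>On elements, \<open>l\<close> is \<open>(\<phi>\<^sub>1(f(a)), d)\<close>, further \<open>y\<close> is \<open>(f(a), \<chi>\<^sup>#(\<phi>\<^sub>1(f(a)), d))\<close>, and \<open>z\<close> is
    \<open>(f(a), d)\<close>.\<close>
  define l where "l = pb_lift E \<chi>1 r (\<phi>1 \<cdot> (f \<cdot> ?b)) ?t"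
  have f1: "\<phi>1 \<cdot> f \<in> Arr E" "Cod E (\<phi>1 \<cdot> f) = Cod E q"
    using \<phi>' f by auto
  note Q = pb_backward[OF \<chi>, of \<phi>1] and S = pb_backward[OF \<chi> f1]
    and R = pb_backward[OF \<phi> f] and A = pb_backward[OF poly_comp_arr[OF \<phi> \<chi>] f]
  have as: "(\<chi>1 \<cdot> \<phi>1) \<cdot> f = \<chi>1 \<cdot> (\<phi>1 \<cdot> f)" "(\<phi>1 \<cdot> f) \<cdot> ?b = \<phi>1 \<cdot> (f \<cdot> ?b)"
    using \<phi>' \<chi>' f by auto
  have sq: "\<chi>1 \<cdot> (\<phi>1 \<cdot> (f \<cdot> ?b)) = r \<cdot> ?t"
    using \<phi>' \<chi>' f pb_projections(7)[of "\<chi>1 \<cdot> (\<phi>1 \<cdot> f)" r] by (simp del: pb_projections(7))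
  have l: "l \<in> Arr E" "Dom E l = pb E (\<chi>1 \<cdot> (\<phi>1 \<cdot> f)) r" "Cod E l = pb E \<chi>1 r"
      "pb_base E \<chi>1 r \<cdot> l = \<phi>1 \<cdot> (f \<cdot> ?b)"
    using \<phi>' \<chi>' f sq by (auto simp: l_def)
  have sq': "\<phi>1 \<cdot> (f \<cdot> ?b) = q \<cdot> (\<chi>s \<cdot> l)"
    using \<chi> l by simp
  have S_top: "pb_top E (\<phi>1 \<cdot> f) q \<cdot> ?S = \<chi>s \<cdot> l"
    using S(5) by (simp only: as l_def)
  have S_eq: "?S = pb_lift E (\<phi>1 \<cdot> f) q ?b (\<chi>s \<cdot> l)"
    by (rule pb_ext[of "\<phi>1 \<cdot> f" q]) (use S(1-4) S_top as \<phi>' \<chi>' f l sq' in auto)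
  define y where "y = pb_lift E \<phi>1 q (f \<cdot> ?b) (\<chi>s \<cdot> l)"
  define z where "z = pb_lift E (\<chi>1 \<cdot> \<phi>1) r (f \<cdot> ?b) ?t"
  have y: "y \<in> Arr E" "Dom E y = pb E (\<chi>1 \<cdot> (\<phi>1 \<cdot> f)) r" "Cod E y = pb E \<phi>1 q"
      "pb_base E \<phi>1 q \<cdot> y = f \<cdot> ?b"
    using \<phi>' \<chi>' f l sq' by (auto simp: y_def)
  have z: "z \<in> Arr E" "Cod E z = pb E (\<chi>1 \<cdot> \<phi>1) r"
    using \<phi>' \<chi>' f sq by (auto simp: z_def)
  have Qz: "?Q \<cdot> z = y"
    using pb_backward_lift[OF \<chi>, of \<phi>1 "f \<cdot> ?b" ?t] \<phi>' \<chi>' f sq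
    by (simp add: l_def y_def z_def)
  have "pb_top E f p \<cdot> ?A = (\<phi>s \<cdot> ?Q) \<cdot> z"
    using A(5) by (simp only: as z_def)
  also have "\<dots> = \<phi>s \<cdot> y"
    using Q \<phi>' \<chi>' z by (simp add: Qz)
  finally have A_top: "pb_top E f p \<cdot> ?A = \<phi>s \<cdot> y" .
  have py: "f \<cdot> ?b = p \<cdot> (\<phi>s \<cdot> y)"
    using \<phi> y by simp
  have "?A = pb_lift E f p ?b (\<phi>s \<cdot> y)"
    by (rule pb_ext[of f p]) (use A(1-4) A_top as py y \<phi>' \<chi>' f in auto)
  also have "\<dots> = ?R \<cdot> ?S"
    unfolding S_eq y_def
    by (rule pb_backward_lift[OF \<phi> f, symmetric]) (use \<phi>' \<chi>' f l sq' in auto)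
  finally show ?thesis .
qed

lemma poly_ident_arr:
  assumes "p \<in> Arr E"
  shows "(p, Ident E (Cod E p), pb_top E (Ident E (Cod E p)) p, p) \<in> Arr (Poly E)"
  using assms pb_projections(7)[of "Ident E (Cod E p)" p]
  by (simp add: poly_arr_iff del: pb_projections(7))

text \<open>
  Reindexing sees the canonical map \<open>id\<^sup>*p \<rightarrow> p\<close> as an identity between chosen pullbacks, which
  is why identities are preserved strictly.
\<close>

lemma pb_backward_ident:
  assumes "f \<in> Arr E" "p \<in> Arr E" "Cod E f = Cod E p"
  shows "pb_backward E f p (Ident E (Cod E p)) (pb_top E (Ident E (Cod E p)) p) p =
    Ident E (pb E f p)"
  by (rule pb_ext[of f p]) (use assms pb_backward[OF poly_ident_arr[of p], of f] in auto)

lemma pb_top_backward_ident: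
  assumes \<phi>: "(p, \<phi>1, \<phi>s, q) \<in> Arr (Poly E)"
  shows "pb_top E (Ident E (Cod E p)) p \<cdot> pb_backward E (Ident E (Cod E p)) p \<phi>1 \<phi>s q = \<phi>s"
  using pb_backward[OF \<phi>, of "Ident E (Cod E p)"] \<phi>[unfolded poly_arr_iff] by simp

lemma category_Poly: "category (Poly E)"
proof
  fix \<phi> assume "\<phi> \<in> Arr (Poly E)"
  then show "Dom (Poly E) \<phi> \<in> Obj (Poly E)" "Cod (Poly E) \<phi> \<in> Obj (Poly E)"
    by (auto simp: Poly_def)
next
  fix p assume "p \<in> Obj (Poly E)"
  then show "Ident (Poly E) p \<in> Hom (Poly E) p p"
    using poly_ident_arr[of p] by (simp add: Poly_def Hom_def)
next
  fix \<phi> \<chi> p q r assume "\<phi> \<in> Hom (Poly E) p q" "\<chi> \<in> Hom (Poly E) q r"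
  then obtain \<phi>1 \<phi>s \<chi>1 \<chi>s where eq: "\<phi> = (p, \<phi>1, \<phi>s, q)" "\<chi> = (q, \<chi>1, \<chi>s, r)"
    and arr: "(p, \<phi>1, \<phi>s, q) \<in> Arr (Poly E)" "(q, \<chi>1, \<chi>s, r) \<in> Arr (Poly E)"
    by (cases \<phi>, cases \<chi>) (auto simp: Poly_def Hom_def)
  show "\<chi> \<cdot>\<^bsub>Poly E\<^esub> \<phi> \<in> Hom (Poly E) p r"
    unfolding eq poly_comp_eq[OF arr] using poly_comp_arr[OF arr] by (auto simp: Hom_def Poly_def)
next
  fix \<phi> p q assume "\<phi> \<in> Hom (Poly E) p q"
  then obtain \<phi>1 \<phi>s where eq: "\<phi> = (p, \<phi>1, \<phi>s, q)" and arr: "(p, \<phi>1, \<phi>s, q) \<in> Arr (Poly E)"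
    by (cases \<phi>) (auto simp: Poly_def Hom_def)
  note arr' = arr[unfolded poly_arr_iff]
  have id: "Ident (Poly E) x = (x, Ident E (Cod E x), pb_top E (Ident E (Cod E x)) x, x)" for x
    by (simp add: Poly_def)
  show "\<phi> \<cdot>\<^bsub>Poly E\<^esub> Ident (Poly E) p = \<phi>"
    using poly_comp_eq[OF poly_ident_arr arr] pb_top_backward_ident[OF arr] arr'
    by (simp add: eq id)
  show "Ident (Poly E) q \<cdot>\<^bsub>Poly E\<^esub> \<phi> = \<phi>"
    using poly_comp_eq[OF arr poly_ident_arr] pb_backward_ident[of \<phi>1 q] arr'
    by (simp add: eq id)
next
  fix \<phi> \<chi> \<psi> p q r s
  assume "\<phi> \<in> Hom (Poly E) p q" "\<chi> \<in> Hom (Poly E) q r" "\<psi> \<in> Hom (Poly E) r s"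
  then obtain \<phi>1 \<phi>s \<chi>1 \<chi>s \<psi>1 \<psi>s where
      eq: "\<phi> = (p, \<phi>1, \<phi>s, q)" "\<chi> = (q, \<chi>1, \<chi>s, r)" "\<psi> = (r, \<psi>1, \<psi>s, s)"
    and \<phi>: "(p, \<phi>1, \<phi>s, q) \<in> Arr (Poly E)" and \<chi>: "(q, \<chi>1, \<chi>s, r) \<in> Arr (Poly E)"
    and \<psi>: "(r, \<psi>1, \<psi>s, s) \<in> Arr (Poly E)"
    by (cases \<phi>, cases \<chi>, cases \<psi>) (auto simp: Poly_def Hom_def)
  note p' = \<phi>[unfolded poly_arr_iff] \<chi>[unfolded poly_arr_iff] \<psi>[unfolded poly_arr_iff]
  show "\<psi> \<cdot>\<^bsub>Poly E\<^esub> (\<chi> \<cdot>\<^bsub>Poly E\<^esub> \<phi>) = (\<psi> \<cdot>\<^bsub>Poly E\<^esub> \<chi>) \<cdot>\<^bsub>Poly E\<^esub> \<phi>"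
    unfolding eq poly_comp_eq[OF \<phi> \<chi>] poly_comp_eq[OF \<chi> \<psi>]
      poly_comp_eq[OF poly_comp_arr[OF \<phi> \<chi>] \<psi>] poly_comp_eq[OF \<phi> poly_comp_arr[OF \<chi> \<psi>]]
    using pb_backward_comp[OF \<chi> \<psi>, of \<phi>1] pb_backward[OF \<chi>, of \<phi>1]
      pb_backward[OF \<psi>, of "\<chi>1 \<cdot> \<phi>1"] p' by simp
qed

end


section \<open>Coalgebras\<close>

definition push_coalgebra ::
    "('o, 'a) cat \<Rightarrow> 'a \<times> 'a \<times> 'a \<times> 'a \<Rightarrow> 'o \<times> 'a \<times> 'a \<Rightarrow> 'o \<times> 'a \<times> 'a" where
  "push_coalgebra E = (\<lambda>(p, \<phi>1, \<phi>s, q) (X, \<theta>o, \<theta>u).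
     (X, \<phi>1 \<cdot>\<^bsub>E\<^esub> \<theta>o, \<theta>u \<cdot>\<^bsub>E\<^esub> pb_backward E \<theta>o p \<phi>1 \<phi>s q))"

lemma fst_push_coalgebra [simp]: "fst (push_coalgebra E \<phi> \<theta>) = fst \<theta>"
  by (simp add: push_coalgebra_def case_prod_unfold)

locale coalgebra_setting = pullback_category E
  for E :: "('o, 'a) cat" (structure) and T :: "('o, 'a) monad" and M :: "('o, 'a) monoid_obj" +
  assumes endofunctor: "is_functor E E (endo T)"
    and time_obj [simp]: "mcarrier M \<in> Obj E"
    and has_terminal: "\<exists>t. is_terminal E t"
    and has_products: "a \<in> Obj E \<Longrightarrow> b \<in> Obj E \<Longrightarrow> \<exists>p q. is_product E a b p q"
begin

abbreviation "TO \<equiv> omap (endo T)"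
abbreviation "TA \<equiv> amap (endo T)"

lemma endofunctor_simps [simp]:
  shows "x \<in> Obj E \<Longrightarrow> TO x \<in> Obj E"
    and "f \<in> Arr E \<Longrightarrow> TA f \<in> Arr E"
    and "f \<in> Arr E \<Longrightarrow> Dom E (TA f) = TO (Dom E f)"
    and "f \<in> Arr E \<Longrightarrow> Cod E (TA f) = TO (Cod E f)"
    and "x \<in> Obj E \<Longrightarrow> TA (Ident E x) = Ident E (TO x)"
    and "f \<in> Arr E \<Longrightarrow> g \<in> Arr E \<Longrightarrow> Cod E f = Dom E g \<Longrightarrow> TA (g \<cdot> f) = TA g \<cdot> TA f"
  using endofunctor by (auto simp: is_functor_def hom_iff)

lemma bang_arr [simp]:
  assumes "x \<in> Obj E"
  shows "bang E x \<in> Arr E" "Dom E (bang E x) = x" "Cod E (bang E x) = One E"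
proof -
  have "is_terminal E (One E)"
    unfolding One_def using has_terminal by (rule someI_ex)
  then have "\<exists>!f. f \<in> Hom E x (One E)"
    using assms by (simp add: is_terminal_def)
  from theI'[OF this] show "bang E x \<in> Arr E" "Dom E (bang E x) = x" "Cod E (bang E x) = One E"
    by (simp_all add: bang_def hom_iff)
qed

lemma pairing_arr:
  assumes "f \<in> Arr E" "g \<in> Arr E" "Dom E f = Dom E g"
  shows "pairing E f g \<in> Hom E (Dom E f) (Prod E (Cod E f) (Cod E g))"
proof -
  let ?a = "Cod E f" and ?b = "Cod E g"
  have "\<exists>pq. case pq of (p, q) \<Rightarrow> is_product E ?a ?b p q"
    using has_products[of ?a ?b] assms by auto
  from someI_ex[OF this] have "is_product E ?a ?b (pr1 E ?a ?b) (pr2 E ?a ?b)"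
    by (simp add: pr1_def pr2_def projs_def case_prod_unfold)
  then have "\<exists>!h. h \<in> Hom E (Dom E f) (Prod E ?a ?b) \<and> pr1 E ?a ?b \<cdot> h = f \<and> pr2 E ?a ?b \<cdot> h = g"
    using assms dom_obj[OF assms(1)] by (simp add: is_product_def Prod_def hom_iff)
  from theI'[OF this] show ?thesis
    by (simp add: pairing_def)
qed

lemma at_time_arr [simp]:
  assumes "t \<in> Hom E (One E) (mcarrier M)" "S \<in> Obj E"
  shows "at_time E t S \<in> Arr E" "Dom E (at_time E t S) = S"
    "Cod E (at_time E t S) = Prod E (mcarrier M) S"
  using pairing_arr[of "t \<cdot> bang E S" "Ident E S"] assms by (simp_all add: at_time_def hom_iff)

lemma is_coalgebraD:
  assumes "is_coalgebra E T M p (S, \<theta>o, \<theta>u)"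
  shows "S \<in> Obj E" "\<theta>o \<in> Arr E" "Dom E \<theta>o = Prod E (mcarrier M) S" "Cod E \<theta>o = Cod E p"
    "\<theta>u \<in> Arr E" "Dom E \<theta>u = pb E \<theta>o p" "Cod E \<theta>u = TO S"
  using assms by (auto simp: is_coalgebra_def hom_iff)

lemma section_lift_square:
  assumes "is_section E p \<sigma>" "p \<in> Arr E" "f \<in> Arr E" "Cod E f = Cod E p"
  shows "\<sigma> \<cdot> f \<in> Arr E" "Dom E (\<sigma> \<cdot> f) = Dom E f" "Cod E (\<sigma> \<cdot> f) = Dom E p" "p \<cdot> (\<sigma> \<cdot> f) = f"
proof -
  have s: "\<sigma> \<in> Arr E" "Dom E \<sigma> = Cod E p" "Cod E \<sigma> = Dom E p" "p \<cdot> \<sigma> = Ident E (Cod E p)"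
    using assms(1) by (auto simp: is_section_def hom_iff)
  then show "\<sigma> \<cdot> f \<in> Arr E" "Dom E (\<sigma> \<cdot> f) = Dom E f" "Cod E (\<sigma> \<cdot> f) = Dom E p"
    "p \<cdot> (\<sigma> \<cdot> f) = f"
    using comp_assoc_arr[of f \<sigma> p] assms by auto
qed

lemma pb_section:
  assumes "is_section E p \<sigma>" "p \<in> Arr E" "f \<in> Arr E" "Cod E f = Cod E p"
  shows "pb_section E f p \<sigma> \<in> Arr E" "Dom E (pb_section E f p \<sigma>) = Dom E f"
    "Cod E (pb_section E f p \<sigma>) = pb E f p"
    "pb_base E f p \<cdot> pb_section E f p \<sigma> = Ident E (Dom E f)"
    "pb_top E f p \<cdot> pb_section E f p \<sigma> = \<sigma> \<cdot> f"
  using section_lift_square[OF assms] assms by (auto simp: pb_section_def)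

text \<open>
  On elements the closure is \<open>s \<mapsto> \<theta>\<^sup>u(t, s, \<sigma>(\<theta>\<^sup>o(t, s)))\<close>. In this form, \<open>\<theta>\<^sup>u\<close> is applied to a
  single lift, instead of being restricted to time \<open>t\<close> first.
\<close>

lemma closure_at_eq:
  assumes "S \<in> Obj E" "\<theta>o \<in> Arr E" "Dom E \<theta>o = Prod E (mcarrier M) S" "Cod E \<theta>o = Cod E p"
    and "\<theta>u \<in> Arr E" "Dom E \<theta>u = pb E \<theta>o p"
    and "p \<in> Arr E" "is_section E p \<sigma>" "t \<in> Hom E (One E) (mcarrier M)"
  shows "closure_at E p (S, \<theta>o, \<theta>u) \<sigma> t =
    \<theta>u \<cdot> pb_lift E \<theta>o p (at_time E t S) (\<sigma> \<cdot> (\<theta>o \<cdot> at_time E t S))"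
proof -
  let ?a = "at_time E t S"
  let ?b = "pb_base E (\<theta>o \<cdot> ?a) p" and ?t = "pb_top E (\<theta>o \<cdot> ?a) p"
  let ?s = "pb_section E (\<theta>o \<cdot> ?a) p \<sigma>"
  let ?L = "pb_lift E \<theta>o p (?a \<cdot> ?b) ?t"
  have a: "?a \<in> Arr E" "Dom E ?a = S" "Cod E ?a = Prod E (mcarrier M) S"
    using assms by auto
  have s: "?s \<in> Arr E" "Dom E ?s = S" "Cod E ?s = pb E (\<theta>o \<cdot> ?a) p"
      "?b \<cdot> ?s = Ident E S" "?t \<cdot> ?s = \<sigma> \<cdot> (\<theta>o \<cdot> ?a)"
    using pb_section[of p \<sigma> "\<theta>o \<cdot> ?a"] assms a by auto
  have sq: "\<theta>o \<cdot> (?a \<cdot> ?b) = p \<cdot> ?t"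
    using assms a pb_projections(7)[of "\<theta>o \<cdot> ?a" p] by (simp del: pb_projections(7))
  have L: "?L \<in> Arr E" "Dom E ?L = pb E (\<theta>o \<cdot> ?a) p" "Cod E ?L = pb E \<theta>o p"
    using assms a sq by auto
  have "?L \<cdot> ?s = pb_lift E \<theta>o p ((?a \<cdot> ?b) \<cdot> ?s) (?t \<cdot> ?s)"
    using assms a s(1-3) sq by (intro pb_lift_comp) auto
  also have "(?a \<cdot> ?b) \<cdot> ?s = ?a"
    using assms a s by simp
  finally have "?L \<cdot> ?s = pb_lift E \<theta>o p ?a (\<sigma> \<cdot> (\<theta>o \<cdot> ?a))"
    by (simp only: s)
  moreover have "(\<theta>u \<cdot> ?L) \<cdot> ?s = \<theta>u \<cdot> (?L \<cdot> ?s)"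
    using assms L s by (intro comp_assoc_arr) auto
  ultimately show ?thesis
    by (simp add: closure_at_def upd_at_def out_at_def)
qed

lemma closure_at_arr:
  assumes "is_coalgebra E T M p \<theta>" "p \<in> Arr E" "is_section E p \<sigma>"
    "t \<in> Hom E (One E) (mcarrier M)"
  shows "closure_at E p \<theta> \<sigma> t \<in> Arr E" "Dom E (closure_at E p \<theta> \<sigma> t) = fst \<theta>"
    "Cod E (closure_at E p \<theta> \<sigma> t) = TO (fst \<theta>)" "fst \<theta> \<in> Obj E"
proof -
  obtain S \<theta>o \<theta>u where \<theta>: "\<theta> = (S, \<theta>o, \<theta>u)" by (cases \<theta>)
  note D = is_coalgebraD[OF assms(1)[unfolded \<theta>]]
  let ?a = "at_time E t S"
  have "p \<cdot> (\<sigma> \<cdot> (\<theta>o \<cdot> ?a)) = \<theta>o \<cdot> ?a"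
    using section_lift_square[of p \<sigma> "\<theta>o \<cdot> ?a"] D assms by simp
  then show "closure_at E p \<theta> \<sigma> t \<in> Arr E" "Dom E (closure_at E p \<theta> \<sigma> t) = fst \<theta>"
    "Cod E (closure_at E p \<theta> \<sigma> t) = TO (fst \<theta>)" "fst \<theta> \<in> Obj E"
    using section_lift_square[of p \<sigma> "\<theta>o \<cdot> ?a"] D assms by (simp_all add: \<theta> closure_at_eq)
qed

text \<open>
  The pulled back section is \<open>i \<mapsto> \<phi>\<^sup>#(i, \<sigma>(\<phi>\<^sub>1(i)))\<close>.
\<close>

lemma pull_section:
  assumes \<phi>: "(p, \<phi>1, \<phi>s, q) \<in> Arr (Poly E)" and \<sigma>: "is_section E q \<sigma>"
  shows "is_section E p (\<phi>s \<cdot> pb_section E \<phi>1 q \<sigma>)"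
  using pb_section[OF \<sigma>, of \<phi>1] \<phi> \<phi>[unfolded poly_arr_iff] by (simp add: is_section_def hom_iff)

text \<open>
  Answering the pushed coalgebra by \<open>\<sigma>\<close> and translating back, or answering the original one by
  the translated section, gives \<open>\<theta>\<^sup>u(t, s, \<phi>\<^sup>#(i, \<sigma>(\<phi>\<^sub>1(i))))\<close> for \<open>i = \<theta>\<^sup>o(t, s)\<close> either way.
\<close>

lemma closure_push_coalgebra:
  assumes \<phi>: "(p, \<phi>1, \<phi>s, q) \<in> Arr (Poly E)" and \<theta>: "is_coalgebra E T M p \<theta>"
    and \<sigma>: "is_section E q \<sigma>" and t: "t \<in> Hom E (One E) (mcarrier M)"
  shows "closure_at E q (push_coalgebra E (p, \<phi>1, \<phi>s, q) \<theta>) \<sigma> t =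
    closure_at E p \<theta> (\<phi>s \<cdot> pb_section E \<phi>1 q \<sigma>) t"
proof -
  obtain S \<theta>o \<theta>u where \<theta>_eq: "\<theta> = (S, \<theta>o, \<theta>u)" by (cases \<theta>)
  note D = is_coalgebraD[OF \<theta>[unfolded \<theta>_eq]] and \<phi>' = \<phi>[unfolded poly_arr_iff]
  note R = pb_backward[OF \<phi>, of \<theta>o]
  let ?a = "at_time E t S" and ?R = "pb_backward E \<theta>o p \<phi>1 \<phi>s q"
  let ?x = "\<theta>o \<cdot> ?a"
  let ?y = "\<sigma> \<cdot> (\<phi>1 \<cdot> ?x)"
  have a: "?a \<in> Arr E" "Dom E ?a = S" "Cod E ?a = Prod E (mcarrier M) S"
    using D t by auto
  have y: "?y \<in> Arr E" "Dom E ?y = S" "Cod E ?y = Dom E q" "q \<cdot> ?y = \<phi>1 \<cdot> ?x"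
    using section_lift_square[OF \<sigma>, of "\<phi>1 \<cdot> ?x"] D \<phi>' a by auto
  have w: "pb_lift E (\<phi>1 \<cdot> \<theta>o) q ?a ?y \<in> Arr E"
      "Cod E (pb_lift E (\<phi>1 \<cdot> \<theta>o) q ?a ?y) = pb E (\<phi>1 \<cdot> \<theta>o) q"
    using D \<phi>' a y by auto
  have s: "pb_section E \<phi>1 q \<sigma> \<cdot> ?x = pb_lift E \<phi>1 q ?x ?y"
  proof (rule pb_ext[of \<phi>1 q])
    show "pb_base E \<phi>1 q \<cdot> (pb_section E \<phi>1 q \<sigma> \<cdot> ?x) = pb_base E \<phi>1 q \<cdot> pb_lift E \<phi>1 q ?x ?y"
      using comp_assoc_arr[of ?x "pb_section E \<phi>1 q \<sigma>" "pb_base E \<phi>1 q"]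
        pb_section[OF \<sigma>, of \<phi>1] D \<phi>' a y by simp
    have "\<sigma> \<in> Arr E" "Dom E \<sigma> = Cod E q"
      using \<sigma> by (auto simp: is_section_def hom_iff)
    then show "pb_top E \<phi>1 q \<cdot> (pb_section E \<phi>1 q \<sigma> \<cdot> ?x) = pb_top E \<phi>1 q \<cdot> pb_lift E \<phi>1 q ?x ?y"
      using comp_assoc_arr[of ?x "pb_section E \<phi>1 q \<sigma>" "pb_top E \<phi>1 q"]
        pb_section[OF \<sigma>, of \<phi>1] D \<phi>' a y by simp
  qed (use pb_section[OF \<sigma>, of \<phi>1] D \<phi>' a y in auto)
  have "closure_at E q (push_coalgebra E (p, \<phi>1, \<phi>s, q) \<theta>) \<sigma> t =
      (\<theta>u \<cdot> ?R) \<cdot> pb_lift E (\<phi>1 \<cdot> \<theta>o) q ?a (\<sigma> \<cdot> ((\<phi>1 \<cdot> \<theta>o) \<cdot> ?a))"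
    unfolding \<theta>_eq push_coalgebra_def prod.case
    using D \<phi>' R \<sigma> t by (intro closure_at_eq) auto
  also have "(\<phi>1 \<cdot> \<theta>o) \<cdot> ?a = \<phi>1 \<cdot> ?x"
    using D \<phi>' a by simp
  also have "(\<theta>u \<cdot> ?R) \<cdot> pb_lift E (\<phi>1 \<cdot> \<theta>o) q ?a ?y = \<theta>u \<cdot> (?R \<cdot> pb_lift E (\<phi>1 \<cdot> \<theta>o) q ?a ?y)"
    using D \<phi>' R w by (intro comp_assoc_arr) auto
  also have "?R \<cdot> pb_lift E (\<phi>1 \<cdot> \<theta>o) q ?a ?y =
      pb_lift E \<theta>o p ?a (\<phi>s \<cdot> pb_lift E \<phi>1 q ?x ?y)"
    using D \<phi>' a y by (intro pb_backward_lift[OF \<phi>]) auto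
  also have "\<phi>s \<cdot> pb_lift E \<phi>1 q ?x ?y = (\<phi>s \<cdot> pb_section E \<phi>1 q \<sigma>) \<cdot> ?x"
    using pb_section[OF \<sigma>, of \<phi>1] D \<phi>' a by (simp add: s)
  also have "\<theta>u \<cdot> pb_lift E \<theta>o p ?a ((\<phi>s \<cdot> pb_section E \<phi>1 q \<sigma>) \<cdot> ?x) =
      closure_at E p \<theta> (\<phi>s \<cdot> pb_section E \<phi>1 q \<sigma>) t"
    unfolding \<theta>_eq using D \<phi>' t pull_section[OF \<phi> \<sigma>] by (intro closure_at_eq[symmetric]) auto
  finally show ?thesis .
qed

text \<open>
  Every closure of the pushed coalgebra is a closure of the original one, so functoriality in time
  is inherited.
\<close>

lemma is_coalgebra_push:
  assumes \<phi>: "(p, \<phi>1, \<phi>s, q) \<in> Arr (Poly E)" and \<theta>: "is_coalgebra E T M p \<theta>"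
  shows "is_coalgebra E T M q (push_coalgebra E (p, \<phi>1, \<phi>s, q) \<theta>)"
proof -
  obtain S \<theta>o \<theta>u where \<theta>_eq: "\<theta> = (S, \<theta>o, \<theta>u)" by (cases \<theta>)
  note D = is_coalgebraD[OF \<theta>[unfolded \<theta>_eq]] and \<phi>' = \<phi>[unfolded poly_arr_iff]
  note R = pb_backward[OF \<phi>, of \<theta>o]
  have "is_functor (delooping E M) (kleisli E T)
      (closure_functor E T M q (push_coalgebra E (p, \<phi>1, \<phi>s, q) \<theta>) \<sigma>)"
    if \<sigma>: "is_section E q \<sigma>" for \<sigma>
  proof -
    have "closure_functor E T M q (push_coalgebra E (p, \<phi>1, \<phi>s, q) \<theta>) \<sigma> =
        closure_functor E T M p \<theta> (\<phi>s \<cdot> pb_section E \<phi>1 q \<sigma>)"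
      unfolding closure_functor_def using closure_push_coalgebra[OF \<phi> \<theta> \<sigma>]
      by (auto simp: delooping_def intro!: restrict_ext)
    then show ?thesis
      using \<theta> pull_section[OF \<phi> \<sigma>] by (simp add: is_coalgebra_def \<theta>_eq)
  qed
  then show ?thesis
    using D \<phi>' R by (simp add: \<theta>_eq push_coalgebra_def is_coalgebra_def hom_iff)
qed

lemma push_coalgebra_ident:
  assumes "p \<in> Arr E" "is_coalgebra E T M p \<theta>"
  shows "push_coalgebra E (Ident (Poly E) p) \<theta> = \<theta>"
proof -
  obtain S \<theta>o \<theta>u where \<theta>_eq: "\<theta> = (S, \<theta>o, \<theta>u)" by (cases \<theta>)
  show ?thesis
    using is_coalgebraD[OF assms(2)[unfolded \<theta>_eq]] assms(1)
    by (simp add: push_coalgebra_def \<theta>_eq Poly_def pb_backward_ident)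
qed

lemma push_coalgebra_comp:
  assumes \<phi>: "(p, \<phi>1, \<phi>s, q) \<in> Arr (Poly E)" and \<chi>: "(q, \<chi>1, \<chi>s, r) \<in> Arr (Poly E)"
    and \<theta>: "is_coalgebra E T M p \<theta>"
  shows "push_coalgebra E ((q, \<chi>1, \<chi>s, r) \<cdot>\<^bsub>Poly E\<^esub> (p, \<phi>1, \<phi>s, q)) \<theta> =
    push_coalgebra E (q, \<chi>1, \<chi>s, r) (push_coalgebra E (p, \<phi>1, \<phi>s, q) \<theta>)"
proof -
  obtain S \<theta>o \<theta>u where \<theta>_eq: "\<theta> = (S, \<theta>o, \<theta>u)" by (cases \<theta>)
  note D = is_coalgebraD[OF \<theta>[unfolded \<theta>_eq]]
  show ?thesis
    unfolding poly_comp_eq[OF \<phi> \<chi>]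
    using D \<phi>[unfolded poly_arr_iff] \<chi>[unfolded poly_arr_iff] pb_backward_comp[OF \<phi> \<chi>, of \<theta>o]
      pb_backward[OF \<phi>, of \<theta>o] pb_backward[OF \<chi>, of "\<phi>1 \<cdot> \<theta>o"]
    by (simp add: \<theta>_eq push_coalgebra_def)
qed

lemma coalg_arr_iff:
  "(\<theta>, f, \<psi>) \<in> Arr (Coalg E T M p) \<longleftrightarrow>
     is_coalgebra E T M p \<theta> \<and> is_coalgebra E T M p \<psi> \<and>
     f \<in> Arr E \<and> Dom E f = fst \<theta> \<and> Cod E f = fst \<psi> \<and>
     (\<forall>t \<in> Hom E (One E) (mcarrier M). \<forall>\<sigma>. is_section E p \<sigma> \<longrightarrow>
        TA f \<cdot> closure_at E p \<theta> \<sigma> t = closure_at E p \<psi> \<sigma> t \<cdot> f)"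
  by (auto simp: Coalg_def hom_iff)

lemma coalg_simps [simp]:
  shows "\<theta> \<in> Obj (Coalg E T M p) \<longleftrightarrow> is_coalgebra E T M p \<theta>"
    and "Dom (Coalg E T M p) (\<theta>, f, \<psi>) = \<theta>" "Cod (Coalg E T M p) (\<theta>, f, \<psi>) = \<psi>"
    and "Ident (Coalg E T M p) \<theta> = (\<theta>, Ident E (fst \<theta>), \<theta>)"
    and "(\<psi>', g, \<chi>) \<cdot>\<^bsub>Coalg E T M p\<^esub> (\<theta>, f, \<psi>) = (\<theta>, g \<cdot> f, \<chi>)"
  by (auto simp: Coalg_def)

lemma coalg_hom_iff:
  "\<alpha> \<in> Hom (Coalg E T M p) \<theta> \<psi> \<longleftrightarrow> (\<exists>f. \<alpha> = (\<theta>, f, \<psi>) \<and> (\<theta>, f, \<psi>) \<in> Arr (Coalg E T M p))"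
  by (cases \<alpha>) (auto simp: Hom_def)

lemma category_Coalg:
  assumes p: "p \<in> Arr E"
  shows "category (Coalg E T M p)"
proof
  fix \<alpha> assume "\<alpha> \<in> Arr (Coalg E T M p)"
  then show "Dom (Coalg E T M p) \<alpha> \<in> Obj (Coalg E T M p)"
      "Cod (Coalg E T M p) \<alpha> \<in> Obj (Coalg E T M p)"
    by (cases \<alpha>; simp add: coalg_arr_iff)+
next
  fix \<theta> assume "\<theta> \<in> Obj (Coalg E T M p)"
  then have \<theta>: "is_coalgebra E T M p \<theta>" by simp
  then have "fst \<theta> \<in> Obj E" by (cases \<theta>) (auto dest: is_coalgebraD)
  then show "Ident (Coalg E T M p) \<theta> \<in> Hom (Coalg E T M p) \<theta> \<theta>"
    using \<theta> closure_at_arr[OF \<theta> p] by (auto simp: coalg_hom_iff coalg_arr_iff)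
next
  fix \<alpha> \<beta> \<theta> \<psi> \<chi> assume "\<alpha> \<in> Hom (Coalg E T M p) \<theta> \<psi>" "\<beta> \<in> Hom (Coalg E T M p) \<psi> \<chi>"
  then obtain f g where eq: "\<alpha> = (\<theta>, f, \<psi>)" "\<beta> = (\<psi>, g, \<chi>)"
    and f: "(\<theta>, f, \<psi>) \<in> Arr (Coalg E T M p)" and g: "(\<psi>, g, \<chi>) \<in> Arr (Coalg E T M p)"
    by (auto simp: coalg_hom_iff)
  note f' = f[unfolded coalg_arr_iff] and g' = g[unfolded coalg_arr_iff]
  have "TA (g \<cdot> f) \<cdot> closure_at E p \<theta> \<sigma> t = closure_at E p \<chi> \<sigma> t \<cdot> (g \<cdot> f)"
    if t: "t \<in> Hom E (One E) (mcarrier M)" and \<sigma>: "is_section E p \<sigma>" for t \<sigma>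
  proof -
    let ?c = "\<lambda>\<theta>. closure_at E p \<theta> \<sigma> t"
    have c: "?c \<kappa> \<in> Arr E" "Dom E (?c \<kappa>) = fst \<kappa>" "Cod E (?c \<kappa>) = TO (fst \<kappa>)"
      if "is_coalgebra E T M p \<kappa>" for \<kappa>
      using closure_at_arr[OF that p \<sigma> t] by auto
    have "TA (g \<cdot> f) \<cdot> ?c \<theta> = TA g \<cdot> (TA f \<cdot> ?c \<theta>)"
      using f' g' c by simp
    also have "\<dots> = TA g \<cdot> (?c \<psi> \<cdot> f)"
      using f' t \<sigma> by simp
    also have "\<dots> = (TA g \<cdot> ?c \<psi>) \<cdot> f"
      using f' g' c by simp
    also have "\<dots> = (?c \<chi> \<cdot> g) \<cdot> f"
      using g' t \<sigma> by simp
    also have "\<dots> = ?c \<chi> \<cdot> (g \<cdot> f)"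
      using f' g' c by simp
    finally show ?thesis .
  qed
  then show "\<beta> \<cdot>\<^bsub>Coalg E T M p\<^esub> \<alpha> \<in> Hom (Coalg E T M p) \<theta> \<chi>"
    using f' g' by (simp add: eq coalg_hom_iff coalg_arr_iff)
qed (auto simp: coalg_hom_iff coalg_arr_iff)

text \<open>
  Both components are restricted to the objects and arrows of the source, so that strict
  functoriality becomes equality of records.
\<close>

definition coalg_functor ::
    "'a \<times> 'a \<times> 'a \<times> 'a \<Rightarrow>
     ('o \<times> 'a \<times> 'a, ('o \<times> 'a \<times> 'a) \<times> 'a \<times> ('o \<times> 'a \<times> 'a),
      'o \<times> 'a \<times> 'a, ('o \<times> 'a \<times> 'a) \<times> 'a \<times> ('o \<times> 'a \<times> 'a)) cfun" where
  "coalg_functor \<phi> =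
     \<lparr>src = Coalg E T M (Dom (Poly E) \<phi>), tgt = Coalg E T M (Cod (Poly E) \<phi>),
      omap = restrict (push_coalgebra E \<phi>) (Obj (Coalg E T M (Dom (Poly E) \<phi>))),
      amap = restrict (\<lambda>(\<theta>, f, \<psi>). (push_coalgebra E \<phi> \<theta>, f, push_coalgebra E \<phi> \<psi>))
        (Arr (Coalg E T M (Dom (Poly E) \<phi>)))\<rparr>"

lemma poly_dom_cod [simp]:
  "Dom (Poly E) (p, \<phi>1, \<phi>s, q) = p" "Cod (Poly E) (p, \<phi>1, \<phi>s, q) = q"
  by (simp_all add: Poly_def)

lemma push_coalgebra_arr:
  assumes \<phi>: "(p, \<phi>1, \<phi>s, q) \<in> Arr (Poly E)" and f: "(\<theta>, f, \<psi>) \<in> Arr (Coalg E T M p)"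
  shows "(push_coalgebra E (p, \<phi>1, \<phi>s, q) \<theta>, f, push_coalgebra E (p, \<phi>1, \<phi>s, q) \<psi>)
    \<in> Arr (Coalg E T M q)"
  using f is_coalgebra_push[OF \<phi>] closure_push_coalgebra[OF \<phi>] pull_section[OF \<phi>]
  by (simp add: coalg_arr_iff)

lemma is_functor_coalg_functor:
  assumes \<phi>: "(p, \<phi>1, \<phi>s, q) \<in> Arr (Poly E)"
  shows "is_functor (Coalg E T M p) (Coalg E T M q) (coalg_functor (p, \<phi>1, \<phi>s, q))"
proof -
  have pq: "p \<in> Arr E" "q \<in> Arr E"
    using \<phi> by (auto simp: poly_arr_iff)
  interpret P: category "Coalg E T M p" by (rule category_Coalg[OF pq(1)])
  show ?thesis
    unfolding is_functor_def
  proof (intro conjI allI ballI)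
    fix \<alpha> \<beta> \<theta> \<psi> \<chi> assume \<alpha>\<beta>: "\<alpha> \<in> Hom (Coalg E T M p) \<theta> \<psi>" "\<beta> \<in> Hom (Coalg E T M p) \<psi> \<chi>"
    then have "\<beta> \<cdot>\<^bsub>Coalg E T M p\<^esub> \<alpha> \<in> Arr (Coalg E T M p)"
      using P.comp_hom P.hom_iff by blast
    with \<alpha>\<beta> show "amap (coalg_functor (p, \<phi>1, \<phi>s, q)) (\<beta> \<cdot>\<^bsub>Coalg E T M p\<^esub> \<alpha>) =
        amap (coalg_functor (p, \<phi>1, \<phi>s, q)) \<beta> \<cdot>\<^bsub>Coalg E T M q\<^esub>
        amap (coalg_functor (p, \<phi>1, \<phi>s, q)) \<alpha>"
      by (auto simp: coalg_hom_iff coalg_functor_def)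
  next
    fix \<theta> assume "\<theta> \<in> Obj (Coalg E T M p)"
    then show "amap (coalg_functor (p, \<phi>1, \<phi>s, q)) (Ident (Coalg E T M p) \<theta>) =
        Ident (Coalg E T M q) (omap (coalg_functor (p, \<phi>1, \<phi>s, q)) \<theta>)"
      using P.ident_arr(1)[of \<theta>] by (simp add: coalg_functor_def)
  qed (use category_Coalg pq push_coalgebra_arr[OF \<phi>] is_coalgebra_push[OF \<phi>] in
      \<open>auto simp: coalg_functor_def coalg_arr_iff[of _ _ _ p]\<close>)
qed

lemma coalg_functor_ident:
  assumes "p \<in> Arr E"
  shows "coalg_functor (Ident (Poly E) p) = id_functor (Coalg E T M p)"
proof -
  have "Dom (Poly E) (Ident (Poly E) p) = p" "Cod (Poly E) (Ident (Poly E) p) = p"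
    by (simp_all add: Poly_def)
  then show ?thesis
    using push_coalgebra_ident[OF assms]
    by (auto simp: coalg_functor_def id_functor_def coalg_arr_iff intro!: restrict_ext)
qed

lemma coalg_functor_comp:
  assumes \<phi>: "(p, \<phi>1, \<phi>s, q) \<in> Arr (Poly E)" and \<chi>: "(q, \<chi>1, \<chi>s, r) \<in> Arr (Poly E)"
  shows "coalg_functor ((q, \<chi>1, \<chi>s, r) \<cdot>\<^bsub>Poly E\<^esub> (p, \<phi>1, \<phi>s, q)) =
    comp_functor (coalg_functor (q, \<chi>1, \<chi>s, r)) (coalg_functor (p, \<phi>1, \<phi>s, q))"
proof -
  let ?c = "(q, \<chi>1, \<chi>s, r) \<cdot>\<^bsub>Poly E\<^esub> (p, \<phi>1, \<phi>s, q)"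
  have "Dom (Poly E) ?c = p" "Cod (Poly E) ?c = r"
    by (simp_all add: poly_comp_eq[OF \<phi> \<chi>])
  then show ?thesis
    using push_coalgebra_comp[OF \<phi> \<chi>] is_coalgebra_push[OF \<phi>] push_coalgebra_arr[OF \<phi>]
    by (auto simp: coalg_functor_def comp_functor_def coalg_arr_iff[of _ _ _ p] intro!: restrict_ext)
qed

end


section \<open>The category of categories\<close>

lemma is_functor_id: "category C \<Longrightarrow> is_functor C C (id_functor C)"
proof -
  assume "category C"
  then interpret category C .
  show ?thesis
    by (auto simp: is_functor_def id_functor_def hom_iff category_axioms)
qed

lemma is_functor_comp:
  assumes F: "is_functor C D F" and G: "is_functor D B G"
  shows "is_functor C B (comp_functor G F)"
proof -
  interpret C: category C using F by (simp add: is_functor_def)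
  have o: "omap F x \<in> Obj D" if "x \<in> Obj C" for x
    using F that by (auto simp: is_functor_def)
  have a: "amap F f \<in> Hom D (omap F x) (omap F y)" if "f \<in> Hom C x y" for f x y
    using F that by (auto simp: is_functor_def Hom_def)
  show ?thesis
    unfolding is_functor_def
  proof (intro conjI allI ballI)
    fix x y z f g assume fg: "f \<in> Hom C x y" "g \<in> Hom C y z"
    then have "g \<cdot>\<^bsub>C\<^esub> f \<in> Arr C" "f \<in> Arr C" "g \<in> Arr C"
      by (auto simp: C.hom_iff)
    moreover have "amap F (g \<cdot>\<^bsub>C\<^esub> f) = amap F g \<cdot>\<^bsub>D\<^esub> amap F f"
      using F fg by (auto simp: is_functor_def)
    moreover have "amap G (amap F g \<cdot>\<^bsub>D\<^esub> amap F f) = amap G (amap F g) \<cdot>\<^bsub>B\<^esub> amap G (amap F f)"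
      using G a[OF fg(1)] a[OF fg(2)] unfolding is_functor_def by blast
    ultimately show "amap (comp_functor G F) (g \<cdot>\<^bsub>C\<^esub> f) =
        amap (comp_functor G F) g \<cdot>\<^bsub>B\<^esub> amap (comp_functor G F) f"
      using F by (simp add: comp_functor_def is_functor_def)
  qed (use F G o in \<open>auto simp: is_functor_def comp_functor_def PiE_iff\<close>)
qed

lemma is_functor_src_tgt: "is_functor C D F \<Longrightarrow> src F = C \<and> tgt F = D"
  by (simp add: is_functor_def)

lemma hom_Cat_iff: "F \<in> Hom Cat C D \<longleftrightarrow> is_functor C D F"
  by (auto simp: Cat_def Hom_def dest: is_functor_src_tgt)

lemma category_Cat: "category Cat"
proof
  fix F :: "('a, 'b, 'a, 'b) cfun" assume "F \<in> Arr Cat"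
  then show "Dom Cat F \<in> Obj Cat" "Cod Cat F \<in> Obj Cat"
    by (auto simp: Cat_def is_functor_def)
next
  fix C :: "('a, 'b) cat" assume "C \<in> Obj Cat"
  then show "Ident Cat C \<in> Hom Cat C C"
    unfolding hom_Cat_iff by (simp add: Cat_def is_functor_id)
next
  fix F G :: "('a, 'b, 'a, 'b) cfun" and B C D
  assume "F \<in> Hom Cat B C" "G \<in> Hom Cat C D"
  then show "G \<cdot>\<^bsub>Cat\<^esub> F \<in> Hom Cat B D"
    unfolding hom_Cat_iff by (simp add: Cat_def is_functor_comp)
next
  fix F :: "('a, 'b, 'a, 'b) cfun" and C D
  assume "F \<in> Hom Cat C D"
  then have F: "is_functor C D F" by (simp add: hom_Cat_iff)
  then interpret C: category C by (simp add: is_functor_def)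
  have x: "restrict (omap F) (Obj C) = omap F" "restrict (amap F) (Arr C) = amap F"
    using F by (auto simp: is_functor_def PiE_restrict)
  have "omap F x \<in> Obj D" "amap F f \<in> Arr D" if "x \<in> Obj C" "f \<in> Arr C" for x f
    using F that by (auto simp: is_functor_def)
  then show "F \<cdot>\<^bsub>Cat\<^esub> Ident Cat C = F" "Ident Cat D \<cdot>\<^bsub>Cat\<^esub> F = F"
    using F x by (auto simp: Cat_def comp_functor_def id_functor_def is_functor_def
        intro!: cfun.equality ext)
next
  fix F G H :: "('a, 'b, 'a, 'b) cfun" and A B C D
  assume "F \<in> Hom Cat A B" "G \<in> Hom Cat B C" "H \<in> Hom Cat C D"
  then have "is_functor A B F" "is_functor B C G" "is_functor C D H"
    by (simp_all add: hom_Cat_iff)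
  then show "H \<cdot>\<^bsub>Cat\<^esub> (G \<cdot>\<^bsub>Cat\<^esub> F) = (H \<cdot>\<^bsub>Cat\<^esub> G) \<cdot>\<^bsub>Cat\<^esub> F"
    by (auto simp: Cat_def comp_functor_def is_functor_def PiE_iff intro!: restrict_ext)
qed


section \<open>Finite limits in a locally Cartesian closed category\<close>

text \<open>
  An arrow into \<open>f\<close> in the slice carries its composite with \<open>f\<close> as source, so a pair of arrows with
  common source in the slice is the same as a commuting square over \<open>x\<close>.
\<close>

lemma is_product_slice_imp_is_pullback:
  assumes C: "category C"
    and f: "f \<in> Arr C" "Cod C f = x" and p: "p \<in> Arr C" "Cod C p = x"
    and PQ: "is_product (slice C x) f p P Q"
  shows "is_pullback C f p (fst (snd P)) (fst (snd Q))"
proof -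
  interpret category C by (rule C)
  obtain d b t where P: "P = (d, b, f)" and Q: "Q = (d, t, p)"
    using PQ by (cases P; cases Q) (auto simp: is_product_def slice_def Hom_def)
  have d: "d \<in> Arr C" "Cod C d = x" and b: "b \<in> Arr C" "Dom C b = Dom C d" "Cod C b = Dom C f"
    and t: "t \<in> Arr C" "Dom C t = Dom C d" "Cod C t = Dom C p"
    and fb: "f \<cdot>\<^bsub>C\<^esub> b = d" and pt: "p \<cdot>\<^bsub>C\<^esub> t = d"
    using PQ by (auto simp: P Q is_product_def slice_def Hom_def)
  have univ: "\<exists>!h. h \<in> Hom C y (Dom C b) \<and> b \<cdot>\<^bsub>C\<^esub> h = u \<and> t \<cdot>\<^bsub>C\<^esub> h = v"
    if u: "u \<in> Hom C y (Dom C f)" and v: "v \<in> Hom C y (Dom C p)"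
      and uv: "f \<cdot>\<^bsub>C\<^esub> u = p \<cdot>\<^bsub>C\<^esub> v" for y u v
  proof -
    let ?e = "f \<cdot>\<^bsub>C\<^esub> u"
    have e: "?e \<in> Obj (slice C x)" "(?e, u, f) \<in> Hom (slice C x) ?e f"
        "(?e, v, p) \<in> Hom (slice C x) ?e p"
      using f p u v uv by (auto simp: slice_def Hom_def)
    have "\<exists>!H. H \<in> Hom (slice C x) ?e d \<and> P \<cdot>\<^bsub>slice C x\<^esub> H = (?e, u, f) \<and>
        Q \<cdot>\<^bsub>slice C x\<^esub> H = (?e, v, p)"
      using PQ e by (auto simp: is_product_def P slice_def)
    moreover have "(?e, h, d) \<in> Hom (slice C x) ?e d \<and> P \<cdot>\<^bsub>slice C x\<^esub> (?e, h, d) = (?e, u, f) \<and>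
          Q \<cdot>\<^bsub>slice C x\<^esub> (?e, h, d) = (?e, v, p) \<longleftrightarrow>
        h \<in> Hom C y (Dom C b) \<and> b \<cdot>\<^bsub>C\<^esub> h = u \<and> t \<cdot>\<^bsub>C\<^esub> h = v" for h
      using f u b d t comp_assoc_arr[of h b f]
      by (auto simp: slice_def Hom_def P Q fb)
    moreover have "\<exists>h. H = (?e, h, d)" if "H \<in> Hom (slice C x) ?e d" for H
      using that by (cases H) (auto simp: slice_def Hom_def)
    ultimately show ?thesis
      by (smt (verit, best) prod.inject)
  qed
  have "b \<in> Hom C (Dom C b) (Dom C f)" "t \<in> Hom C (Dom C b) (Dom C p)"
    using b t by (auto simp: hom_iff)
  moreover have "f \<cdot>\<^bsub>C\<^esub> b = p \<cdot>\<^bsub>C\<^esub> t"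
    using fb pt by simp
  ultimately show ?thesis
    using univ
    unfolding is_pullback_def P Q fst_conv snd_conv by blast
qed

lemma lcc_has_pullbacks:
  assumes lcc: "locally_cartesian_closed C"
    and f: "f \<in> Arr C" and p: "p \<in> Arr C" "Cod C f = Cod C p"
  shows "\<exists>b t. is_pullback C f p b t"
proof -
  interpret category C using lcc by (simp add: locally_cartesian_closed_def)
  have "cartesian_closed (slice C (Cod C f))"
    using lcc f by (simp add: locally_cartesian_closed_def)
  then obtain P Q where "is_product (slice C (Cod C f)) f p P Q"
    using f p by (fastforce simp: cartesian_closed_def slice_def)
  from is_product_slice_imp_is_pullback[OF category_axioms f refl p(1) p(2)[symmetric] this]
  show ?thesis by blast
qed

text \<open>
  Products are pullbacks over a terminal object.
\<close>

lemma lcc_has_products: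
  assumes lcc: "locally_cartesian_closed C" and a: "a \<in> Obj C" and b: "b \<in> Obj C"
  shows "\<exists>p q. is_product C a b p q"
proof -
  interpret category C using lcc by (simp add: locally_cartesian_closed_def)
  obtain z where z: "is_terminal C z"
    using lcc by (auto simp: locally_cartesian_closed_def)
  then obtain f g where f: "f \<in> Hom C a z" and g: "g \<in> Hom C b z"
    using a b unfolding is_terminal_def by blast
  then obtain p q where pq: "is_pullback C f g p q"
    using lcc_has_pullbacks[OF lcc, of f g] by (auto simp: hom_iff)
  have "f \<cdot>\<^bsub>C\<^esub> u = g \<cdot>\<^bsub>C\<^esub> v" if "x \<in> Obj C" "u \<in> Hom C x a" "v \<in> Hom C x b" for x u v
    using z that(1) comp_hom[OF that(2) f] comp_hom[OF that(3) g] unfolding is_terminal_def by blast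
  then have "is_product C a b p q"
    using pq f g unfolding is_pullback_def is_product_def by (auto simp: hom_iff)
  then show ?thesis by blast
qed


section \<open>The indexed category\<close>

theorem proposition3p48:
  fixes E :: "('o, 'a) cat" and T :: "('o, 'a) monad" and M :: "('o, 'a) monoid_obj"
  assumes "locally_cartesian_closed E"
    and "is_monad E T"
    and "is_monoid_obj E M"
  shows "\<exists>F. is_functor (Poly E) Cat F \<and>
    (\<forall>p \<in> Obj (Poly E). omap F p = Coalg E T M p) \<and>
    (\<forall>p \<phi>1 \<phi>s q. (p, \<phi>1, \<phi>s, q) \<in> Arr (Poly E) \<longrightarrow>
      (\<forall>X \<theta>o \<theta>u. (X, \<theta>o, \<theta>u) \<in> Obj (Coalg E T M p) \<longrightarrow>
        omap (amap F (p, \<phi>1, \<phi>s, q)) (X, \<theta>o, \<theta>u) =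
          (X, \<phi>1 \<cdot>\<^bsub>E\<^esub> \<theta>o,
           \<theta>u \<cdot>\<^bsub>E\<^esub> (pb_map E \<theta>o (pb_base E \<phi>1 q) p \<phi>s \<cdot>\<^bsub>E\<^esub> pb_comp E \<phi>1 \<theta>o q))) \<and>
      (\<forall>\<theta> f \<psi>. (\<theta>, f, \<psi>) \<in> Arr (Coalg E T M p) \<longrightarrow>
        amap (amap F (p, \<phi>1, \<phi>s, q)) (\<theta>, f, \<psi>) =
          (omap (amap F (p, \<phi>1, \<phi>s, q)) \<theta>, f, omap (amap F (p, \<phi>1, \<phi>s, q)) \<psi>)))"
proof -
  interpret category E
    using assms(1) by (simp add: locally_cartesian_closed_def)
  interpret coalgebra_setting E T M
  proof
    show "is_functor E E (endo T)"
      using assms(2) by (simp add: is_monad_def)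
    show "mcarrier M \<in> Obj E"
      using assms(3) by (simp add: is_monoid_obj_def Let_def)
    show "\<exists>t. is_terminal E t"
      using assms(1) by (simp add: locally_cartesian_closed_def)
  qed (use lcc_has_pullbacks[OF assms(1)] lcc_has_products[OF assms(1)] in auto)
  interpret P: category "Poly E" by (rule category_Poly)
  define F where "F = \<lparr>src = Poly E, tgt = Cat, omap = restrict (Coalg E T M) (Obj (Poly E)),
    amap = restrict coalg_functor (Arr (Poly E))\<rparr>"
  have obj: "Obj (Poly E) = Arr E"
    by (simp add: Poly_def)
  have arr: "coalg_functor \<phi> \<in> Hom Cat (Coalg E T M (Dom (Poly E) \<phi>)) (Coalg E T M (Cod (Poly E) \<phi>))"
    if "\<phi> \<in> Arr (Poly E)" for \<phi>
    using that is_functor_coalg_functor by (cases \<phi>) (simp add: hom_Cat_iff)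
  have "is_functor (Poly E) Cat F"
    unfolding is_functor_def
  proof (intro conjI allI ballI)
    fix p assume p: "p \<in> Obj (Poly E)"
    then have "amap F (Ident (Poly E) p) = id_functor (Coalg E T M p)"
      using coalg_functor_ident by (simp add: F_def obj)
    then show "amap F (Ident (Poly E) p) = Ident Cat (omap F p)"
      using p by (simp add: F_def Cat_def)
  next
    fix p q r \<phi> \<chi> assume h: "\<phi> \<in> Hom (Poly E) p q" "\<chi> \<in> Hom (Poly E) q r"
    then obtain \<phi>1 \<phi>s \<chi>1 \<chi>s where eq: "\<phi> = (p, \<phi>1, \<phi>s, q)" "\<chi> = (q, \<chi>1, \<chi>s, r)"
      by (cases \<phi>, cases \<chi>) (auto simp: Poly_def Hom_def)
    have "\<phi> \<in> Arr (Poly E)" "\<chi> \<in> Arr (Poly E)" "\<chi> \<cdot>\<^bsub>Poly E\<^esub> \<phi> \<in> Arr (Poly E)"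
      using h by (auto simp: P.hom_iff)
    then show "amap F (\<chi> \<cdot>\<^bsub>Poly E\<^esub> \<phi>) = amap F \<chi> \<cdot>\<^bsub>Cat\<^esub> amap F \<phi>"
      using coalg_functor_comp by (simp add: F_def Cat_def eq)
  next
    show "omap F \<in> Obj (Poly E) \<rightarrow>\<^sub>E Obj Cat"
      using category_Coalg by (auto simp: F_def obj Cat_def)
  qed (use arr category_Poly category_Cat in \<open>auto simp: F_def Hom_def\<close>)
  then show ?thesis
    by (intro exI[of _ F])
      (auto simp: F_def coalg_functor_def coalg_arr_iff push_coalgebra_def pb_backward_def)
qed

end
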